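(* Let $\mathcal{R}=\{\beta,\mu,\rho,\theta,\varepsilon\}$. The set $\mathcal{SN}_{\mathcal{R}}\cap\mathcal{T}_t$ is saturated.
   Context: $\lambda\mu$-terms: $\mathcal{T} ::= x \mid \lambda x.\mathcal{T} \mid (\mathcal{T})\mathcal{T} \mid [\alpha]\mathcal{T} \mid \mu\alpha.\mathcal{T}$, up to renaming of bound variables; substitutions avoid capture. Types $A ::= X \mid \bot \mid A\to B$; typing judgments $\Gamma\vdash M:A;\Theta$ by: $\Gamma,x:A\vdash x:A;\Theta$; $\lambda$-introduction to $A\to B$; application; from $\Gamma\vdash M:A;\alpha:A,\Theta$ infer $\Gamma\vdash[\alpha]M:\bot;\alpha:A,\Theta$; from $\Gamma\vdash M:\bot;\alpha:A,\Theta$ infer $\Gamma\vdash\mu\alpha.M:A;\Theta$. $\mathcal{T}_t$ = typable terms. $(M)P_1\dots P_k=(\dots((M)P_1)\dots)P_k$; $\mathcal{L}^{<\omega}$ = finite sequences from $\mathcal{L}$. $M[\alpha:=\beta]$ renames; $M[\alpha:=_rN]$ replaces inductively each $[\alpha]P$ by $[\alpha](P')N$, and $M[\alpha:=_rN_1\dots N_n]=M[\alpha:=_rN_1]\dots[\alpha:=_rN_n]$; $M_\alpha$ replaces inductively each $[\alpha]P$ by $P$. Rules: $\beta$: $(\lambda x.M)N\to M[x:=N]$; $\mu$: $(\mu\alpha.M)N\to\mu\alpha.M[\alpha:=_rN]$; $\rho$: $[\beta]\mu\alpha.M\to M[\alpha:=\beta]$; $\theta$: $\mu\alpha.[\alpha]M\to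 M$ if $\alpha\notin\mathrm{fv}(M)$; $\varepsilon$: $\mu\alpha.\mu\beta.M\to\mu\alpha.M_\beta$; $\mathcal{SN}_{\mathcal{R}}$: terms with no infinite $\mathcal{R}$-reduction sequence (one step contracts one redex anywhere). Saturated set: $\mathcal{B}\subseteq\mathcal{T}_t$ with (C1) $M\in\mathcal{B}\Rightarrow\lambda x.M\in\mathcal{B}$; (C2) $M\in\mathcal{B}$, $\mu\alpha.M\in\mathcal{T}_t\Rightarrow\mu\alpha.M\in\mathcal{B}$; (C3) $M\in\mathcal{B}$, $[\alpha]M\in\mathcal{T}_t\Rightarrow[\alpha]M\in\mathcal{B}$; (C4) $n\ge0$, $N_1,\dots,N_n\in\mathcal{B}$, $(x)N_1\dots N_n\in\mathcal{T}_t\Rightarrow(x)N_1\dots N_n\in\mathcal{B}$; (C5) $M,N\in\mathcal{T}_t$, $\bar P\in\mathcal{T}_t^{<\omega}$, $N\in\mathcal{B}$, $(\lambda x.M)N\bar P\in\mathcal{T}_t$, $(M[x:=N])\bar P\in\mathcal{B}\Rightarrow(\lambda x.M)N\bar P\in\mathcal{B}$; (C6) $M\in\mathcal{T}_t$, $\bar N\in\mathcal{B}^{<\omega}$, $(\mu\alpha.M)\bar N\in\mathcal{T}_t$, $\mu\alpha.M[\alpha:=_r\bar N]\in\mathcal{B}\Rightarrow(\mu\alpha.M)\bar N\in\mathcal{B}$. *)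

theory Defs
  imports Main
begin

text \<open>
  Terms up to renaming of bound variables are represented by de Bruijn indices, with
  separate index spaces for \<open>\<lambda>\<close>-variables and \<open>\<mu>\<close>-variables.  Only \<open>Lam\<close> shifts the first
  and only \<open>Mu\<close> shifts the second.  An index that points beyond all enclosing
  binders of its kind stands for a free variable: the \<open>n\<close>-th variable \<open>x\<^sub>n\<close> or \<open>\<alpha>\<^sub>n\<close>
  is the index \<open>n\<close> outside all binders.
  \<open>Nam a M\<close> is \<open>[a]M\<close>.
\<close>

datatype trm =
    Var nat
  | Lam trm
  | App trm trm
  | Nam nat trm
  | Mu trm

definition apps :: "trm \<Rightarrow> trm list \<Rightarrow> trm" where
  "apps M Ps = foldl App M Ps"


definition up :: "(nat \<Rightarrow> nat) \<Rightarrow> nat \<Rightarrow> nat" where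
  "up f = case_nat 0 (\<lambda>i. Suc (f i))"

text \<open>Simultaneous renaming of the free \<open>\<lambda>\<close>-variables by \<open>f\<close> and the free \<open>\<mu>\<close>-variables by \<open>g\<close>.\<close>

primrec ren :: "(nat \<Rightarrow> nat) \<Rightarrow> (nat \<Rightarrow> nat) \<Rightarrow> trm \<Rightarrow> trm" where
  "ren f g (Var i) = Var (f i)"
| "ren f g (Lam M) = Lam (ren (up f) g M)"
| "ren f g (App M N) = App (ren f g M) (ren f g N)"
| "ren f g (Nam a M) = Nam (g a) (ren f g M)"
| "ren f g (Mu M) = Mu (ren f (up g) M)"

abbreviation lift_lam :: "trm \<Rightarrow> trm" where
  "lift_lam \<equiv> ren Suc id"

abbreviation lift_mu :: "trm \<Rightarrow> trm" where
  "lift_mu \<equiv> ren id Suc"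

text \<open>Undoes \<open>lift_mu\<close>; only meant for terms in which the \<open>\<mu>\<close>-variable \<open>0\<close> is not free.\<close>

abbreviation lower_mu :: "trm \<Rightarrow> trm" where
  "lower_mu \<equiv> ren id (\<lambda>a. a - 1)"

text \<open>
  Binding a chosen, possibly free, variable: \<open>lam x M\<close> is \<open>\<lambda>x. M\<close> and \<open>mu a M\<close> is \<open>\<mu>a. M\<close>
  in named notation.
\<close>

definition lam :: "nat \<Rightarrow> trm \<Rightarrow> trm" where
  "lam x M = Lam (ren (\<lambda>y. if y = x then 0 else Suc y) id M)"

definition mu :: "nat \<Rightarrow> trm \<Rightarrow> trm" where
  "mu a M = Mu (ren id (\<lambda>b. if b = a then 0 else Suc b) M)"

primrec fv_mu :: "trm \<Rightarrow> nat set" where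
  "fv_mu (Var i) = {}"
| "fv_mu (Lam M) = fv_mu M"
| "fv_mu (App M N) = fv_mu M \<union> fv_mu N"
| "fv_mu (Nam a M) = insert a (fv_mu M)"
| "fv_mu (Mu M) = {a. Suc a \<in> fv_mu M}"

text \<open>
  \<open>subst k N M\<close> is \<open>M[k := N]\<close> for a variable \<open>k\<close> whose binder has just been removed, so the
  indices above \<open>k\<close> are decremented.
\<close>

primrec subst :: "nat \<Rightarrow> trm \<Rightarrow> trm \<Rightarrow> trm" where
  "subst k N (Var i) = (if i < k then Var i else if i = k then N else Var (i - 1))"
| "subst k N (Lam M) = Lam (subst (Suc k) (lift_lam N) M)"
| "subst k N (App M P) = App (subst k N M) (subst k N P)"
| "subst k N (Nam a M) = Nam a (subst k N M)"
| "subst k N (Mu M) = Mu (subst k (lift_mu N) M)"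

text \<open>\<open>rsubst a N M\<close> is \<open>M[a :=\<^sub>r N]\<close>; no binder is removed, so no index changes.\<close>

primrec rsubst :: "nat \<Rightarrow> trm \<Rightarrow> trm \<Rightarrow> trm" where
  "rsubst a N (Var i) = Var i"
| "rsubst a N (Lam M) = Lam (rsubst a (lift_lam N) M)"
| "rsubst a N (App M P) = App (rsubst a N M) (rsubst a N P)"
| "rsubst a N (Nam b M) =
    (if b = a then Nam b (App (rsubst a N M) N) else Nam b (rsubst a N M))"
| "rsubst a N (Mu M) = Mu (rsubst (Suc a) (lift_mu N) M)"

definition rsubsts :: "nat \<Rightarrow> trm list \<Rightarrow> trm \<Rightarrow> trm" where
  "rsubsts a Ns M = foldl (\<lambda>P N. rsubst a N P) M Ns"

text \<open>\<open>erase a M\<close> is \<open>M\<^sub>a\<close>.\<close>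

primrec erase :: "nat \<Rightarrow> trm \<Rightarrow> trm" where
  "erase a (Var i) = Var i"
| "erase a (Lam M) = Lam (erase a M)"
| "erase a (App M N) = App (erase a M) (erase a N)"
| "erase a (Nam b M) = (if b = a then erase a M else Nam b (erase a M))"
| "erase a (Mu M) = Mu (erase (Suc a) M)"


datatype ty = TVar nat | Bot | Arrow ty ty

text \<open>
  A context is a partial map from free variables to types.  \<open>case_nat (Some A) \<Gamma>\<close> is the context
  inside a binder whose variable has type \<open>A\<close>.
\<close>

type_synonym ctxt = "nat \<Rightarrow> ty option"

inductive typing :: "ctxt \<Rightarrow> trm \<Rightarrow> ty \<Rightarrow> ctxt \<Rightarrow> bool" where
  Ax: "\<Gamma> x = Some A \<Longrightarrow> typing \<Gamma> (Var x) A \<Theta>"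
| ArrowI: "typing (case_nat (Some A) \<Gamma>) M B \<Theta> \<Longrightarrow> typing \<Gamma> (Lam M) (Arrow A B) \<Theta>"
| ArrowE: "typing \<Gamma> M (Arrow A B) \<Theta> \<Longrightarrow> typing \<Gamma> N A \<Theta> \<Longrightarrow> typing \<Gamma> (App M N) B \<Theta>"
| BotI: "typing \<Gamma> M A \<Theta> \<Longrightarrow> \<Theta> a = Some A \<Longrightarrow> typing \<Gamma> (Nam a M) Bot \<Theta>"
| BotE: "typing \<Gamma> M Bot (case_nat (Some A) \<Theta>) \<Longrightarrow> typing \<Gamma> (Mu M) A \<Theta>"

definition typable :: "trm set" where
  "typable = {M. \<exists>\<Gamma> A \<Theta>. finite (dom \<Gamma>) \<and> finite (dom \<Theta>) \<and> typing \<Gamma> M A \<Theta>}"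


datatype rule = Beta_rule | Mu_rule | Rho_rule | Theta_rule | Eps_rule

text \<open>
  Each rule in de Bruijn form.  In \<open>mu\<close>, the argument enters the scope of the \<open>\<mu>\<close> and is
  lifted.  In \<open>rho\<close>, the bound variable becomes \<open>b\<close> and the binder disappears.  In \<open>theta\<close>
  and \<open>eps\<close>, one \<open>\<mu>\<close>-binder disappears and its variable no longer occurs in the contractum.
\<close>

inductive contracts :: "rule \<Rightarrow> trm \<Rightarrow> trm \<Rightarrow> bool" where
  beta: "contracts Beta_rule (App (Lam M) N) (subst 0 N M)"
| mu: "contracts Mu_rule (App (Mu M) N) (Mu (rsubst 0 (lift_mu N) M))"
| rho: "contracts Rho_rule (Nam b (Mu M)) (ren id (case_nat b id) M)"
| theta: "0 \<notin> fv_mu M \<Longrightarrow> contracts Theta_rule (Mu (Nam 0 M)) (lower_mu M)"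
| eps: "contracts Eps_rule (Mu (Mu M)) (Mu (lower_mu (erase 0 M)))"

inductive step :: "rule set \<Rightarrow> trm \<Rightarrow> trm \<Rightarrow> bool" for R :: "rule set" where
  root: "r \<in> R \<Longrightarrow> contracts r M M' \<Longrightarrow> step R M M'"
| Lam: "step R M M' \<Longrightarrow> step R (Lam M) (Lam M')"
| AppL: "step R M M' \<Longrightarrow> step R (App M N) (App M' N)"
| AppR: "step R N N' \<Longrightarrow> step R (App M N) (App M N')"
| Nam: "step R M M' \<Longrightarrow> step R (Nam a M) (Nam a M')"
| Mu: "step R M M' \<Longrightarrow> step R (Mu M) (Mu M')"

definition SN :: "rule set \<Rightarrow> trm set" where
  "SN R = {M. \<not> (\<exists>f :: nat \<Rightarrow> trm. f 0 = M \<and> (\<forall>i. step R (f i) (f (Suc i))))}"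


text \<open>
  In \<open>C1\<close> and \<open>C2\<close> the abstracted variable is an arbitrary variable of \<open>M\<close>, and \<open>\<B>\<close> is not assumed
  closed under renaming, so the named binders are used.  In \<open>C5\<close> and \<open>C6\<close> the abstraction is
  given by its body \<open>M\<close>, in which the bound variable is the index \<open>0\<close>.
\<close>

definition saturated :: "trm set \<Rightarrow> bool" where
  "saturated \<B> \<longleftrightarrow>
     \<B> \<subseteq> typable \<and>
     \<comment> \<open>C1\<close>
     (\<forall>x M. M \<in> \<B> \<longrightarrow> lam x M \<in> \<B>) \<and>
     \<comment> \<open>C2\<close>
     (\<forall>a M. M \<in> \<B> \<longrightarrow> mu a M \<in> typable \<longrightarrow> mu a M \<in> \<B>) \<and>
     \<comment> \<open>C3\<close>
     (\<forall>a M. M \<in> \<B> \<longrightarrow> Nam a M \<in> typable \<longrightarrow> Nam a M \<in> \<B>) \<and>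
     \<comment> \<open>C4\<close>
     (\<forall>x Ns. set Ns \<subseteq> \<B> \<longrightarrow> apps (Var x) Ns \<in> typable \<longrightarrow> apps (Var x) Ns \<in> \<B>) \<and>
     \<comment> \<open>C5\<close>
     (\<forall>M N Ps. M \<in> typable \<longrightarrow> N \<in> typable \<longrightarrow> set Ps \<subseteq> typable \<longrightarrow> N \<in> \<B> \<longrightarrow>
        apps (App (Lam M) N) Ps \<in> typable \<longrightarrow> apps (subst 0 N M) Ps \<in> \<B> \<longrightarrow>
        apps (App (Lam M) N) Ps \<in> \<B>) \<and>
     \<comment> \<open>C6\<close>
     (\<forall>M Ns. M \<in> typable \<longrightarrow> set Ns \<subseteq> \<B> \<longrightarrow> apps (Mu M) Ns \<in> typable \<longrightarrow>
        Mu (rsubsts 0 (map lift_mu Ns) M) \<in> \<B> \<longrightarrow>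
        apps (Mu M) Ns \<in> \<B>)"

end

theory Submission
  imports Defs
begin

text \<open>
  For typable terms, strong normalization for all five rules is the same as strong normalization
  for \<open>\<beta>\<mu>\<close>, so that the saturation conditions need only be checked for \<open>\<beta>\<mu>\<close>.  There they are
  easy: \<open>\<mu>\<alpha>. M\<close> and \<open>[\<alpha>]M\<close> are never redexes, and \<open>\<beta>\<mu>\<close>-steps of \<open>M\<close> are simulated in \<open>M[x := N]\<close>
  and \<open>M[\<alpha> :=\<^sub>r N]\<close>.

  The equivalence holds because the other rules decrease the size, and because a \<open>\<beta>\<mu>\<close>-step that
  follows a \<open>\<rho>\<close>-, \<open>\<theta>\<close>- or \<open>\<epsilon>\<close>-step can be performed first.  Typing is needed for \<open>\<rho>\<close> and \<open>\<epsilon>\<close>: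
  without it, contracting \<open>[\<beta>]\<mu>\<alpha>. \<lambda>x. M\<close> or erasing the name in \<open>[\<beta>]\<lambda>x. M\<close> could create
  a \<open>\<beta>\<close>-redex, but a named term has type \<open>\<bottom>\<close> and cannot be applied.
\<close>

section \<open>Simultaneous substitution\<close>

primrec name :: "nat option \<Rightarrow> trm \<Rightarrow> trm" where
  "name None M = M"
| "name (Some c) M = Nam c M"

text \<open>
  \<open>psub \<sigma> \<nu> \<pi>\<close> replaces every \<open>[a]P\<close> by \<open>[\<nu> a](P')\<pi> a\<close>, the name being erased if
  \<open>\<nu> a = None\<close>.  Renaming, both substitutions and erasure are instances, so that all their
  commutation properties are instances of the composition law \<open>psub_psub\<close>.
\<close>

primrec psub :: "(nat \<Rightarrow> trm) \<Rightarrow> (nat \<Rightarrow> nat option) \<Rightarrow> (nat \<Rightarrow> trm list) \<Rightarrow> trm \<Rightarrow> trm" where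
  "psub \<sigma> \<nu> \<pi> (Var i) = \<sigma> i"
| "psub \<sigma> \<nu> \<pi> (Lam M) =
    Lam (psub (case_nat (Var 0) (\<lambda>i. lift_lam (\<sigma> i))) \<nu> (\<lambda>a. map lift_lam (\<pi> a)) M)"
| "psub \<sigma> \<nu> \<pi> (App M N) = App (psub \<sigma> \<nu> \<pi> M) (psub \<sigma> \<nu> \<pi> N)"
| "psub \<sigma> \<nu> \<pi> (Nam a M) = name (\<nu> a) (apps (psub \<sigma> \<nu> \<pi> M) (\<pi> a))"
| "psub \<sigma> \<nu> \<pi> (Mu M) =
    Mu (psub (\<lambda>i. lift_mu (\<sigma> i)) (case_nat (Some 0) (\<lambda>a. map_option Suc (\<nu> a)))
          (case_nat [] (\<lambda>a. map lift_mu (\<pi> a))) M)"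

abbreviation psub_lam ::
  "(nat \<Rightarrow> trm) \<Rightarrow> (nat \<Rightarrow> nat option) \<Rightarrow> (nat \<Rightarrow> trm list) \<Rightarrow> trm \<Rightarrow> trm" where
  "psub_lam \<sigma> \<nu> \<pi> \<equiv>
     psub (case_nat (Var 0) (\<lambda>i. lift_lam (\<sigma> i))) \<nu> (\<lambda>a. map lift_lam (\<pi> a))"

abbreviation psub_mu ::
  "(nat \<Rightarrow> trm) \<Rightarrow> (nat \<Rightarrow> nat option) \<Rightarrow> (nat \<Rightarrow> trm list) \<Rightarrow> trm \<Rightarrow> trm" where
  "psub_mu \<sigma> \<nu> \<pi> \<equiv>
     psub (\<lambda>i. lift_mu (\<sigma> i)) (case_nat (Some 0) (\<lambda>a. map_option Suc (\<nu> a)))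
       (case_nat [] (\<lambda>a. map lift_mu (\<pi> a)))"

section \<open>Laws of renaming and composition of substitutions\<close>

lemma apps_simps [simp]:
  "apps M [] = M" "apps M (P # Ps) = apps (App M P) Ps" "apps M (Ps @ Qs) = apps (apps M Ps) Qs"
  by (simp_all add: apps_def)

lemma up_simps [simp]: "up f 0 = 0" "up f (Suc i) = Suc (f i)"
  by (simp_all add: up_def)

lemma up_id [simp]: "up id = id"
  by (auto simp: up_def fun_eq_iff split: nat.splits)

lemma up_comp: "up f \<circ> up g = up (f \<circ> g)"
  by (auto simp: up_def fun_eq_iff split: nat.splits)

lemma ren_id [simp]: "ren id id M = M"
  by (induction M) (auto simp: up_id[unfolded id_def] id_def)

lemma ren_ren: "ren f g (ren f' g' M) = ren (f \<circ> f') (g \<circ> g') M"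
  by (induction M arbitrary: f g f' g') (auto simp: up_comp)

lemma ren_apps: "ren f g (apps M Ps) = apps (ren f g M) (map (ren f g) Ps)"
  by (induction Ps arbitrary: M) auto

lemma ren_name: "ren f g (name n M) = name (map_option g n) (ren f g M)"
  by (cases n) auto

lemma ren_lift_lam: "ren (up f) g (lift_lam M) = lift_lam (ren f g M)"
  by (simp add: ren_ren comp_def)

lemma ren_lift_mu: "ren f (up g) (lift_mu M) = lift_mu (ren f g M)"
  by (simp add: ren_ren comp_def)

lemma psub_cong:
  "(\<And>i. \<sigma> i = \<sigma>' i) \<Longrightarrow> (\<And>a. \<nu> a = \<nu>' a) \<Longrightarrow> (\<And>a. \<pi> a = \<pi>' a) \<Longrightarrow> M = M' \<Longrightarrow>
    psub \<sigma> \<nu> \<pi> M = psub \<sigma>' \<nu>' \<pi>' M'"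
  by presburger

text \<open>Composition with a renaming, here and in \<open>ren_psub\<close>, has to come before the
  general law: below a binder the substituted terms are lifted, and lifting is a renaming.\<close>

lemma psub_ren: "psub \<sigma> \<nu> \<pi> (ren f g M) = psub (\<lambda>i. \<sigma> (f i)) (\<lambda>a. \<nu> (g a)) (\<lambda>a. \<pi> (g a)) M"
  by (induction M arbitrary: \<sigma> \<nu> \<pi> f g) (auto intro!: psub_cong simp: up_def split: nat.splits)

lemma ren_psub:
  "ren f g (psub \<sigma> \<nu> \<pi> M) =
    psub (\<lambda>i. ren f g (\<sigma> i)) (\<lambda>a. map_option g (\<nu> a)) (\<lambda>a. map (ren f g) (\<pi> a)) M"
  by (induction M arbitrary: \<sigma> \<nu> \<pi> f g)
    (auto intro!: psub_cong
      simp: ren_apps ren_name ren_lift_lam ren_lift_mu option.map_comp comp_def split: nat.splits)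

lemma psub_apps: "psub \<sigma> \<nu> \<pi> (apps M Ps) = apps (psub \<sigma> \<nu> \<pi> M) (map (psub \<sigma> \<nu> \<pi>) Ps)"
  by (induction Ps arbitrary: M) auto

lemma psub_lift_lam:
  "psub (case_nat (Var 0) (\<lambda>i. lift_lam (\<sigma> i))) \<nu> (\<lambda>a. map lift_lam (\<pi> a)) (lift_lam M) =
    lift_lam (psub \<sigma> \<nu> \<pi> M)"
  by (auto simp: psub_ren ren_psub option.map_id intro!: psub_cong)

text \<open>The values \<open>n\<close> and \<open>Ns\<close> at index 0 are arbitrary because the
  name 0 does not occur free in a lifted term.\<close>

lemma psub_lift_mu:
  "psub (\<lambda>i. lift_mu (\<sigma> i)) (case_nat n (\<lambda>a. map_option Suc (\<nu> a)))
     (case_nat Ns (\<lambda>a. map lift_mu (\<pi> a))) (lift_mu M) =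
    lift_mu (psub \<sigma> \<nu> \<pi> M)"
  by (auto simp: psub_ren ren_psub intro!: psub_cong)

text \<open>The arguments of a name accumulate: first \<open>\<pi> a\<close>, transformed by the
  second substitution, then whatever the second one attaches to the new name. An erased name offers
  nothing to attach to, hence the empty list.\<close>

lemma psub_psub:
  "psub \<sigma>' \<nu>' \<pi>' (psub \<sigma> \<nu> \<pi> M) =
    psub (\<lambda>i. psub \<sigma>' \<nu>' \<pi>' (\<sigma> i)) (\<lambda>a. Option.bind (\<nu> a) \<nu>')
      (\<lambda>a. map (psub \<sigma>' \<nu>' \<pi>') (\<pi> a) @ (case \<nu> a of None \<Rightarrow> [] | Some c \<Rightarrow> \<pi>' c)) M"
proof (induction M arbitrary: \<sigma> \<nu> \<pi> \<sigma>' \<nu>' \<pi>')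
  case (Nam a M)
  then show ?case by (cases "\<nu> a") (auto simp: psub_apps)
next
  case (Lam M)
  then show ?case
    by (auto intro!: psub_cong simp: psub_lift_lam split: nat.splits option.splits)
next
  case (Mu M)
  have 1: "Option.bind (map_option Suc n) (case_nat (Some 0) (\<lambda>a. map_option Suc (\<nu>' a))) =
    map_option Suc (Option.bind n \<nu>')" for n
    by (cases n) auto
  show ?case
    by (auto intro!: psub_cong simp: Mu 1 psub_lift_mu split: nat.splits option.splits)
qed auto

section \<open>The operations of the calculus as simultaneous substitutions\<close>

lemma ren_eq_psub: "ren f g M = psub (\<lambda>i. Var (f i)) (\<lambda>a. Some (g a)) (\<lambda>a. []) M"
  by (induction M arbitrary: f g)
    (auto intro!: psub_cong simp: up_def split: nat.splits)

lemma subst_eq_psub: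
  "subst k N M =
    psub (\<lambda>i. if i < k then Var i else if i = k then N else Var (i - 1)) Some (\<lambda>a. []) M"
  by (induction M arbitrary: k N) (auto intro!: psub_cong split: nat.splits)

lemma rsubst_eq_psub: "rsubst a N M = psub Var Some (\<lambda>b. if b = a then [N] else []) M"
  by (induction M arbitrary: a N) (auto intro!: psub_cong split: nat.splits)

lemma erase_eq_psub:
  "erase a M = psub Var (\<lambda>b. if b = a then None else Some b) (\<lambda>b. []) M"
  by (induction M arbitrary: a) (auto intro!: psub_cong split: nat.splits)

lemma psub_Var [simp]: "psub Var Some (\<lambda>a. []) M = M"
  using ren_eq_psub[of id id M] by simp

lemma subst_0_eq_psub: "subst 0 N M = psub (case_nat N Var) Some (\<lambda>a. []) M"
  by (auto simp: subst_eq_psub intro!: psub_cong split: nat.splits)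

lemma rho_eq_psub: "ren id (case_nat b id) M = psub Var (\<lambda>a. Some (case_nat b id a)) (\<lambda>a. []) M"
  by (simp add: ren_eq_psub)

lemma eps_eq_psub: "lower_mu (erase 0 M) = psub Var (case_nat None Some) (\<lambda>a. []) M"
  by (auto simp: erase_eq_psub ren_psub intro!: psub_cong split: nat.splits)

lemma fv_mu_ren: "fv_mu (ren f g M) = g ` fv_mu M"
proof (induction M arbitrary: f g)
  case (Mu M)
  have "Suc a \<in> up g ` A \<longleftrightarrow> a \<in> g ` {b. Suc b \<in> A}" for a A
  proof
    assume "Suc a \<in> up g ` A"
    then obtain b where "b \<in> A" "Suc a = up g b" by blast
    then show "a \<in> g ` {b. Suc b \<in> A}" by (cases b) auto
  next
    assume "a \<in> g ` {b. Suc b \<in> A}"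
    then obtain b where "Suc b \<in> A" "Suc a = up g (Suc b)" by auto
    then show "Suc a \<in> up g ` A" by blast
  qed
  then show ?case
    by (simp add: Mu set_eq_iff)
qed auto

lemma ren_cong_fv_mu: "(\<And>a. a \<in> fv_mu M \<Longrightarrow> g a = g' a) \<Longrightarrow> ren f g M = ren f g' M"
proof (induction M arbitrary: f g g')
  case (Mu M)
  have "ren f (up g) M = ren f (up g') M"
  proof (rule Mu.IH)
    fix a assume "a \<in> fv_mu M"
    then show "up g a = up g' a"
      using Mu.prems by (cases a) auto
  qed
  then show ?case by simp
next
  case (Lam M)
  have "ren (up f) g M = ren (up f) g' M"
    using Lam.prems by (auto intro: Lam.IH)
  then show ?case by simp
next
  case (App M N)
  have "ren f g M = ren f g' M" "ren f g N = ren f g' N"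
    using App.prems by (auto intro: App.IH)
  then show ?case by simp
next
  case (Nam a M)
  have "ren f g M = ren f g' M"
    using Nam.prems by (auto intro: Nam.IH)
  with Nam.prems show ?case by simp
qed simp

lemma lower_lift_mu [simp]: "lower_mu (lift_mu M) = M"
  by (simp add: ren_ren comp_def flip: id_def)

text \<open>With truncated subtraction, \<open>Suc (a - 1) = a\<close> fails only at 0, which is not
  free here.\<close>

lemma lift_lower_mu:
  assumes "0 \<notin> fv_mu M"
  shows "lift_mu (lower_mu M) = M"
proof -
  have "ren id (\<lambda>a. Suc (a - 1)) M = ren id id M"
  proof (rule ren_cong_fv_mu)
    fix a assume "a \<in> fv_mu M"
    with assms show "Suc (a - 1) = id a"
      by (cases a) auto
  qed
  then show ?thesis
    by (simp add: ren_ren comp_def flip: id_def)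
qed

text \<open>By \<open>lift_lower_mu\<close> every \<theta>-redex has this shape. The side condition
  turns into a lifting, which commutes with substitution by \<open>psub_lift_mu\<close>.\<close>

lemma step_Theta: "Theta_rule \<in> R \<Longrightarrow> step R (Mu (Nam 0 (lift_mu M))) M"
  using step.root[OF _ contracts.theta[of "lift_mu M"], of R] unfolding lower_lift_mu
  by (auto simp: fv_mu_ren)

lemma step_Rho: "Rho_rule \<in> R \<Longrightarrow> step R (Nam b (Mu M)) (ren id (case_nat b id) M)"
  and step_Eps: "Eps_rule \<in> R \<Longrightarrow> step R (Mu (Mu M)) (Mu (lower_mu (erase 0 M)))"
  using contracts.rho contracts.eps by (blast intro: step.root)+

lemma subst_lift [simp]: "psub (case_nat N Var) Some (\<lambda>a. []) (lift_lam M) = M"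
  by (simp add: psub_ren)

lemma psub_subst: "psub \<sigma> \<nu> \<pi> (subst 0 N M) = subst 0 (psub \<sigma> \<nu> \<pi> N) (psub_lam \<sigma> \<nu> \<pi> M)"
  unfolding subst_0_eq_psub psub_psub
  by (rule psub_cong) (auto simp: comp_def split: nat.splits option.splits)

lemma psub_mu_rsubst:
  "psub_mu \<sigma> \<nu> \<pi> (rsubst 0 (lift_mu N) M) =
    rsubst 0 (lift_mu (psub \<sigma> \<nu> \<pi> N)) (psub_mu \<sigma> \<nu> \<pi> M)"
  unfolding rsubst_eq_psub psub_psub
  by (rule psub_cong)
    (auto simp: psub_ren ren_psub comp_def simp flip: ren_eq_psub id_def
      split: nat.splits option.splits)

lemma rsubst_0_lift [simp]: "rsubst 0 N (lift_mu M) = lift_mu M"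
  unfolding rsubst_eq_psub psub_ren unfolding ren_eq_psub by simp

text \<open>The erased name is bound, so the substitution neither renames it nor gives it arguments,
  and the order of erasing and substituting does not matter.\<close>

lemma psub_eps:
  "psub_mu \<sigma> \<nu> \<pi> (lower_mu (erase 0 M)) =
    lower_mu (erase 0 (psub_mu (\<lambda>i. lift_mu (\<sigma> i)) (case_nat (Some 0) (\<lambda>a. map_option Suc (\<nu> a)))
       (case_nat [] (\<lambda>a. map lift_mu (\<pi> a))) M))"
  unfolding eps_eq_psub psub_psub
  by (rule psub_cong)
    (auto simp: psub_ren ren_ren bind_map_option map_conv_bind_option comp_def simp flip: ren_eq_psub id_def
      split: nat.splits option.splits)

text \<open>Successive and simultaneous replacement agree because the arguments are lifted: the name
  0 is not free in them, so later replacements leave earlier arguments unchanged.\<close>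

lemma rsubsts_eq_psub:
  "rsubsts 0 (map lift_mu Ns) M = psub Var Some (case_nat (map lift_mu Ns) (\<lambda>a. [])) M"
proof (induction Ns rule: rev_induct)
  case Nil
  have "psub Var Some (case_nat (map lift_mu []) (\<lambda>a. [])) M = psub Var Some (\<lambda>a. []) M"
    by (rule psub_cong) (auto split: nat.splits)
  then show ?case
    by (simp add: rsubsts_def cong del: nat.case_cong_weak)
next
  case (snoc N Ns)
  then have "rsubsts 0 (map lift_mu (Ns @ [N])) M =
    rsubst 0 (lift_mu N) (psub Var Some (case_nat (map lift_mu Ns) (\<lambda>a. [])) M)"
    by (simp only: rsubsts_def map_append list.map foldl_append foldl.simps)
  also have "\<dots> = psub Var Some (case_nat (map lift_mu (Ns @ [N])) (\<lambda>a. [])) M"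
    unfolding rsubst_eq_psub psub_psub
    by (rule psub_cong)
      (auto simp: psub_ren simp flip: ren_eq_psub id_def split: nat.splits)
  finally show ?case .
qed

text \<open>Substitution puts the arguments \<open>\<pi> b\<close> behind the \<mu>-abstraction of a
  \<rho>-redex. The right-hand side is what results when \<mu>-steps have moved them into the body
  and \<rho> has renamed the bound name to \<open>c\<close>.\<close>

lemma psub_rho:
  "\<nu> b = Some c \<Longrightarrow> psub \<sigma> \<nu> \<pi> (ren id (case_nat b id) M) =
    ren id (case_nat c id) (rsubsts 0 (map lift_mu (\<pi> b)) (psub_mu \<sigma> \<nu> \<pi> M))"
  unfolding rsubsts_eq_psub rho_eq_psub psub_psub
  by (rule psub_cong)
    (auto simp: psub_ren ren_ren bind_map_option map_conv_bind_option comp_def simp flip: ren_eq_psub id_def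
      split: nat.splits option.splits Option.bind_splits)

section \<open>Subject reduction\<close>

text \<open>The condition on names is restricted to the free ones for the sake of \<theta>:
  \<open>lower_mu\<close> sends both 0 and 1 to 0, where only the type of the former 1
  survives.\<close>

lemma typing_ren:
  "typing \<Gamma> M A \<Theta> \<Longrightarrow> (\<And>i B. \<Gamma> i = Some B \<Longrightarrow> \<Gamma>' (f i) = Some B) \<Longrightarrow>
    (\<And>a B. a \<in> fv_mu M \<Longrightarrow> \<Theta> a = Some B \<Longrightarrow> \<Theta>' (g a) = Some B) \<Longrightarrow>
    typing \<Gamma>' (ren f g M) A \<Theta>'"
proof (induction arbitrary: \<Gamma>' \<Theta>' f g rule: typing.induct)
  case (ArrowI A \<Gamma> M B \<Theta>)
  have "typing (case_nat (Some A) \<Gamma>') (ren (up f) g M) B \<Theta>'"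
    by (rule ArrowI.IH) (auto simp: up_def intro: ArrowI.prems split: nat.splits)
  then show ?case unfolding ren.simps by (rule typing.ArrowI)
next
  case (BotE \<Gamma> M A \<Theta>)
  have "typing \<Gamma>' (ren f (up g) M) Bot (case_nat (Some A) \<Theta>')"
    by (rule BotE.IH) (auto simp: up_def intro: BotE.prems split: nat.splits)
  then show ?case unfolding ren.simps by (rule typing.BotE)
next
  case (ArrowE \<Gamma> M A B \<Theta> N)
  have "typing \<Gamma>' (ren f g M) (Arrow A B) \<Theta>'"
    by (rule ArrowE.IH(1)) (auto intro: ArrowE.prems)
  moreover have "typing \<Gamma>' (ren f g N) A \<Theta>'"
    by (rule ArrowE.IH(2)) (auto intro: ArrowE.prems)
  ultimately show ?case unfolding ren.simps by (rule typing.ArrowE)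
next
  case (BotI \<Gamma> M A \<Theta> a)
  have "typing \<Gamma>' (ren f g M) A \<Theta>'"
    by (rule BotI.IH) (auto intro: BotI.prems)
  moreover have "\<Theta>' (g a) = Some A"
    using BotI.hyps(2) BotI.prems(2) by simp
  ultimately show ?case unfolding ren.simps by (rule typing.BotI)
qed (auto intro: typing.Ax)

lemma list_all2_map_mono:
  "list_all2 P xs ys \<Longrightarrow> (\<And>x y. P x y \<Longrightarrow> Q (f x) (g y)) \<Longrightarrow> list_all2 Q (map f xs) (map g ys)"
  by (induction rule: list_all2_induct) auto

lemma typing_lift_lam: "typing \<Gamma> M A \<Theta> \<Longrightarrow> typing (case_nat B \<Gamma>) (lift_lam M) A \<Theta>"
  by (erule typing_ren) auto

lemma typing_lift_mu: "typing \<Gamma> M A \<Theta> \<Longrightarrow> typing \<Gamma> (lift_mu M) A (case_nat B \<Theta>)"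
  by (erule typing_ren) auto

lemma typing_apps:
  "typing \<Gamma> M (foldr Arrow Cs C) \<Theta> \<Longrightarrow> list_all2 (\<lambda>N B. typing \<Gamma> N B \<Theta>) Ns Cs \<Longrightarrow>
    typing \<Gamma> (apps M Ns) C \<Theta>"
proof (induction Ns arbitrary: M Cs)
  case (Cons N Ns)
  then obtain D Ds where "Cs = D # Ds" "typing \<Gamma> N D \<Theta>" "list_all2 (\<lambda>N B. typing \<Gamma> N B \<Theta>) Ns Ds"
    by (auto simp: list_all2_Cons1)
  with Cons.prems(1) show ?case
    by (auto intro!: Cons.IH[of _ Ds] intro: ArrowE)
qed auto

text \<open>If the arguments attached to a name have types \<open>Cs\<close>, they consume these
  from the front of its type, and the new name gets the remaining type \<open>C\<close>. When the
  name is erased, the body takes the place of a named term, so \<open>C\<close> has to be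
  \<bottom>.\<close>

definition name_typing ::
  "ctxt \<Rightarrow> ctxt \<Rightarrow> ctxt \<Rightarrow> (nat \<Rightarrow> nat option) \<Rightarrow> (nat \<Rightarrow> trm list) \<Rightarrow> bool" where
  "name_typing \<Theta> \<Gamma>' \<Theta>' \<nu> \<pi> \<longleftrightarrow>
     (\<forall>a B. \<Theta> a = Some B \<longrightarrow> (\<exists>Cs C. B = foldr Arrow Cs C \<and>
        list_all2 (\<lambda>N D. typing \<Gamma>' N D \<Theta>') (\<pi> a) Cs \<and>
        (case \<nu> a of None \<Rightarrow> C = Bot | Some c \<Rightarrow> \<Theta>' c = Some C)))"

lemma name_typingE:
  assumes "name_typing \<Theta> \<Gamma>' \<Theta>' \<nu> \<pi>" "\<Theta> a = Some B"
  obtains Cs C where "B = foldr Arrow Cs C" "list_all2 (\<lambda>N D. typing \<Gamma>' N D \<Theta>') (\<pi> a) Cs"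
    "case \<nu> a of None \<Rightarrow> C = Bot | Some c \<Rightarrow> \<Theta>' c = Some C"
  using assms unfolding name_typing_def by blast

lemma name_typing_lam:
  assumes "name_typing \<Theta> \<Gamma>' \<Theta>' \<nu> \<pi>"
  shows "name_typing \<Theta> (case_nat B \<Gamma>') \<Theta>' \<nu> (\<lambda>a. map lift_lam (\<pi> a))"
  unfolding name_typing_def
proof (intro allI impI)
  fix a A assume "\<Theta> a = Some A"
  then obtain Cs C where "A = foldr Arrow Cs C" "list_all2 (\<lambda>N D. typing \<Gamma>' N D \<Theta>') (\<pi> a) Cs"
    "case \<nu> a of None \<Rightarrow> C = Bot | Some c \<Rightarrow> \<Theta>' c = Some C"
    by (rule name_typingE[OF assms])
  moreover from this(2) have
    "list_all2 (\<lambda>N D. typing (case_nat B \<Gamma>') N D \<Theta>') (map lift_lam (\<pi> a)) (map id Cs)"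
    by (rule list_all2_map_mono) (auto intro: typing_lift_lam)
  ultimately show "\<exists>Cs C. A = foldr Arrow Cs C \<and>
      list_all2 (\<lambda>N D. typing (case_nat B \<Gamma>') N D \<Theta>') (map lift_lam (\<pi> a)) Cs \<and>
      (case \<nu> a of None \<Rightarrow> C = Bot | Some c \<Rightarrow> \<Theta>' c = Some C)"
    by (intro exI[of _ Cs] exI[of _ C]) simp
qed

lemma name_typing_mu:
  assumes "name_typing \<Theta> \<Gamma>' \<Theta>' \<nu> \<pi>"
  shows "name_typing (case_nat B \<Theta>) \<Gamma>' (case_nat B \<Theta>')
    (case_nat (Some 0) (\<lambda>a. map_option Suc (\<nu> a))) (case_nat [] (\<lambda>a. map lift_mu (\<pi> a)))"
  unfolding name_typing_def
proof (intro allI impI)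
  fix b A assume b: "case_nat B \<Theta> b = Some A"
  show "\<exists>Cs C. A = foldr Arrow Cs C \<and>
      list_all2 (\<lambda>N D. typing \<Gamma>' N D (case_nat B \<Theta>')) (case_nat [] (\<lambda>a. map lift_mu (\<pi> a)) b) Cs \<and>
      (case case_nat (Some 0) (\<lambda>a. map_option Suc (\<nu> a)) b of
        None \<Rightarrow> C = Bot | Some c \<Rightarrow> case_nat B \<Theta>' c = Some C)"
  proof (cases b)
    case 0
    with b show ?thesis by (intro exI[of _ "[]"] exI[of _ A]) auto
  next
    case (Suc a)
    with b have "\<Theta> a = Some A"
      by simp
    from assms this obtain Cs C where
      "A = foldr Arrow Cs C" "list_all2 (\<lambda>N D. typing \<Gamma>' N D \<Theta>') (\<pi> a) Cs"
      "case \<nu> a of None \<Rightarrow> C = Bot | Some c \<Rightarrow> \<Theta>' c = Some C"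
      by (rule name_typingE)
    moreover from this(2) have
      "list_all2 (\<lambda>N D. typing \<Gamma>' N D (case_nat B \<Theta>')) (map lift_mu (\<pi> a)) (map id Cs)"
      by (rule list_all2_map_mono) (auto intro: typing_lift_mu)
    ultimately show ?thesis using Suc
      by (intro exI[of _ Cs] exI[of _ C])
        (auto split: option.splits)
  qed
qed

lemma typing_psub:
  "typing \<Gamma> M A \<Theta> \<Longrightarrow> (\<And>i B. \<Gamma> i = Some B \<Longrightarrow> typing \<Gamma>' (\<sigma> i) B \<Theta>') \<Longrightarrow>
    name_typing \<Theta> \<Gamma>' \<Theta>' \<nu> \<pi> \<Longrightarrow> typing \<Gamma>' (psub \<sigma> \<nu> \<pi> M) A \<Theta>'"
proof (induction arbitrary: \<Gamma>' \<Theta>' \<sigma> \<nu> \<pi> rule: typing.induct)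
  case (ArrowI A \<Gamma> M B \<Theta>)
  have "typing (case_nat (Some A) \<Gamma>') (psub_lam \<sigma> \<nu> \<pi> M) B \<Theta>'"
    by (rule ArrowI.IH)
      (use ArrowI.prems in \<open>auto split: nat.splits intro: typing.intros typing_lift_lam name_typing_lam\<close>)
  then show ?case by (auto intro: typing.intros)
next
  case (BotE \<Gamma> M A \<Theta>)
  have "typing \<Gamma>' (psub_mu \<sigma> \<nu> \<pi> M) Bot (case_nat (Some A) \<Theta>')"
    by (rule BotE.IH) (use BotE.prems in \<open>auto intro: typing_lift_mu name_typing_mu\<close>)
  then show ?case by (auto intro: typing.intros)
next
  case (BotI \<Gamma> M A \<Theta> a)
  then obtain Cs C where C: "A = foldr Arrow Cs C" "list_all2 (\<lambda>N D. typing \<Gamma>' N D \<Theta>') (\<pi> a) Cs"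
    "case \<nu> a of None \<Rightarrow> C = Bot | Some c \<Rightarrow> \<Theta>' c = Some C"
    by (blast elim: name_typingE)
  have "typing \<Gamma>' (apps (psub \<sigma> \<nu> \<pi> M) (\<pi> a)) C \<Theta>'"
    by (rule typing_apps[OF _ C(2)]) (use BotI.IH[OF BotI.prems] C(1) in simp)
  with C show ?case by (auto intro: typing.intros split: option.splits)
next
  case (ArrowE \<Gamma> M A B \<Theta> N)
  show ?case
    unfolding psub.simps by (rule typing.ArrowE) (auto intro: ArrowE)
qed auto

inductive_cases typing_LamE: "typing \<Gamma> (Lam M) A \<Theta>"
inductive_cases typing_AppE: "typing \<Gamma> (App M N) A \<Theta>"
inductive_cases typing_NamE: "typing \<Gamma> (Nam a M) A \<Theta>"
inductive_cases typing_MuE: "typing \<Gamma> (Mu M) A \<Theta>"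

lemma typing_contracts: "contracts r M M' \<Longrightarrow> typing \<Gamma> M A \<Theta> \<Longrightarrow> typing \<Gamma> M' A \<Theta>"
proof (induction rule: contracts.induct)
  case (beta M N)
  then obtain B where "typing (case_nat (Some B) \<Gamma>) M A \<Theta>" "typing \<Gamma> N B \<Theta>"
    by (auto elim!: typing_LamE typing_AppE)
  then show ?case
    unfolding subst_0_eq_psub
    by (elim typing_psub)
      (auto simp: name_typing_def split: nat.splits intro: typing.intros exI[of _ "[]"])
next
  case (mu M N)
  then obtain B where M: "typing \<Gamma> M Bot (case_nat (Some (Arrow B A)) \<Theta>)" and N: "typing \<Gamma> N B \<Theta>"
    by (auto elim!: typing_MuE typing_AppE)
  \<comment> \<open>The type of the bound name drops from \<open>Arrow B A\<close> to
    \<open>A\<close>, since every term that it names receives the argument \<open>N\<close> of type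
    \<open>B\<close>.\<close>
  have "name_typing (case_nat (Some (Arrow B A)) \<Theta>) \<Gamma> (case_nat (Some A) \<Theta>) Some
    (\<lambda>b. if b = 0 then [lift_mu N] else [])"
    unfolding name_typing_def
  proof (intro allI impI)
    fix b C assume b: "case_nat (Some (Arrow B A)) \<Theta> b = Some C"
    show "\<exists>Cs D. C = foldr Arrow Cs D \<and>
      list_all2 (\<lambda>N D. typing \<Gamma> N D (case_nat (Some A) \<Theta>)) (if b = 0 then [lift_mu N] else []) Cs \<and>
      (case Some b of None \<Rightarrow> D = Bot | Some c \<Rightarrow> case_nat (Some A) \<Theta> c = Some D)"
    proof (cases b)
      case 0
      with b N show ?thesis
        by (intro exI[of _ "[B]"] exI[of _ A]) (auto intro: typing_lift_mu)
    next
      case (Suc a)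
      with b show ?thesis
        by (intro exI[of _ "[]"] exI[of _ C]) auto
    qed
  qed
  then show ?case
    unfolding rsubst_eq_psub by (intro BotE typing_psub[OF M]) (auto intro: typing.intros)
next
  case (rho b M)
  then obtain B where "A = Bot" "typing \<Gamma> M Bot (case_nat (Some B) \<Theta>)" "\<Theta> b = Some B"
    by (auto elim!: typing_NamE typing_MuE)
  then show ?case
    by (auto elim!: typing_ren split: nat.splits)
next
  case (theta M)
  then have "typing \<Gamma> M A (case_nat (Some A) \<Theta>)"
    by (auto elim!: typing_NamE typing_MuE)
  with theta show ?case
    by (auto elim!: typing_ren split: nat.splits)
next
  case (eps M)
  then have M: "typing \<Gamma> M Bot (case_nat (Some Bot) (case_nat (Some A) \<Theta>))"
    by (auto elim!: typing_MuE)
  \<comment> \<open>The body of the outer \<mu> has type \<bottom>, so the inner bound name, the one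
    that is erased, has type \<bottom> as well.\<close>
  have "name_typing (case_nat (Some Bot) (case_nat (Some A) \<Theta>)) \<Gamma> (case_nat (Some A) \<Theta>)
    (case_nat None Some) (\<lambda>a. [])"
    unfolding name_typing_def by (auto split: nat.splits intro!: exI[of _ "[]"])
  then show ?case
    unfolding eps_eq_psub by (intro BotE typing_psub[OF M]) (auto intro: typing.intros)
qed

lemma typing_step: "step R M M' \<Longrightarrow> typing \<Gamma> M A \<Theta> \<Longrightarrow> typing \<Gamma> M' A \<Theta>"
proof (induction arbitrary: \<Gamma> A \<Theta> rule: step.induct)
  case (AppL M M' N)
  from AppL.prems show ?case
    by (rule typing_AppE) (metis AppL.IH ArrowE)
next
  case (AppR N N' M)
  from AppR.prems show ?case
    by (rule typing_AppE) (metis AppR.IH ArrowE)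
next
  case (Nam M M' a)
  from Nam.prems show ?case
    by (rule typing_NamE) (metis Nam.IH BotI)
qed (auto intro: typing_contracts ArrowI BotE elim!: typing_LamE typing_MuE)

section \<open>Reduction under substitution\<close>

lemma step_mono: "step R M N \<Longrightarrow> R \<subseteq> R' \<Longrightarrow> step R' M N"
  by (induction rule: step.induct) (auto intro: step.intros)

lemma step_Un: "step (R \<union> R') M N \<longleftrightarrow> step R M N \<or> step R' M N"
proof
  show "step (R \<union> R') M N \<Longrightarrow> step R M N \<or> step R' M N"
    by (induction rule: step.induct) (auto intro: step.intros)
qed (auto intro: step_mono)

lemma tranclp_map: "r\<^sup>+\<^sup>+ x y \<Longrightarrow> (\<And>x y. r x y \<Longrightarrow> s (f x) (f y)) \<Longrightarrow> s\<^sup>+\<^sup>+ (f x) (f y)"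
  by (induction rule: tranclp_induct) (auto intro: tranclp.intros)

lemma rtranclp_map: "r\<^sup>*\<^sup>* x y \<Longrightarrow> (\<And>x y. r x y \<Longrightarrow> s (f x) (f y)) \<Longrightarrow> s\<^sup>*\<^sup>* (f x) (f y)"
  by (induction rule: rtranclp_induct) (auto intro: rtranclp.intros)

lemma steps_Lam: "(step R)\<^sup>*\<^sup>* M M' \<Longrightarrow> (step R)\<^sup>*\<^sup>* (Lam M) (Lam M')"
  by (erule rtranclp_map) (rule step.Lam)

lemma steps_Mu: "(step R)\<^sup>*\<^sup>* M M' \<Longrightarrow> (step R)\<^sup>*\<^sup>* (Mu M) (Mu M')"
  by (erule rtranclp_map) (rule step.Mu)

lemma steps_name: "(step R)\<^sup>*\<^sup>* M M' \<Longrightarrow> (step R)\<^sup>*\<^sup>* (name n M) (name n M')"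
  by (cases n) (auto elim: rtranclp_map intro: step.Nam)

lemma steps_App:
  "(step R)\<^sup>*\<^sup>* M M' \<Longrightarrow> (step R)\<^sup>*\<^sup>* N N' \<Longrightarrow> (step R)\<^sup>*\<^sup>* (App M N) (App M' N')"
  by (rule rtranclp_trans[of _ _ "App M' N"])
    (auto elim: rtranclp_map[where f = "\<lambda>M. App M N"] rtranclp_map intro: step.AppL step.AppR)

lemma steps_apps:
  "list_all2 (step R)\<^sup>*\<^sup>* Ns Ns' \<Longrightarrow> (step R)\<^sup>*\<^sup>* M M' \<Longrightarrow> (step R)\<^sup>*\<^sup>* (apps M Ns) (apps M' Ns')"
  by (induction arbitrary: M M' rule: list_all2_induct) (auto intro: steps_App)

lemma step_apps: "step R M M' \<Longrightarrow> step R (apps M Ns) (apps M' Ns)"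
  by (induction Ns arbitrary: M M') (auto intro: step.AppL)

lemma rsubsts_simps [simp]:
  "rsubsts a [] M = M" "rsubsts a (N # Ns) M = rsubsts a Ns (rsubst a N M)"
  by (simp_all add: rsubsts_def)

lemma mu_steps_apps:
  "Mu_rule \<in> R \<Longrightarrow> (step R)\<^sup>*\<^sup>* (apps (Mu M) Ns) (Mu (rsubsts 0 (map lift_mu Ns) M))"
proof (induction Ns arbitrary: M)
  case (Cons N Ns)
  have "step R (apps (App (Mu M) N) Ns) (apps (Mu (rsubst 0 (lift_mu N) M)) Ns)"
    using Cons.prems by (intro step_apps) (auto intro: step.root contracts.intros)
  then show ?case
    unfolding apps_simps rsubsts_simps list.map
    using Cons.IH[OF Cons.prems] by (rule converse_rtranclp_into_rtranclp)
qed simp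

text \<open>
  A name must not be erased: erasing \<open>[b]\<close> in \<open>[b]\<mu>\<alpha>. M\<close> destroys a \<open>\<rho>\<close>-redex.  The \<open>\<mu>\<close>-steps
  are used to bring such a redex into the form \<open>[b]\<mu>\<alpha>. M'\<close> again when \<open>[b]\<close> receives arguments.
\<close>

lemma step_psub:
  "step R M M' \<Longrightarrow> Mu_rule \<in> R \<Longrightarrow> (\<And>a. \<nu> a \<noteq> None) \<Longrightarrow>
    (step R)\<^sup>+\<^sup>+ (psub \<sigma> \<nu> \<pi> M) (psub \<sigma> \<nu> \<pi> M')"
proof (induction arbitrary: \<sigma> \<nu> \<pi> rule: step.induct)
  case (root r M M')
  from root(2) show ?case
  proof cases
    case (beta M N)
    then show ?thesis
      using root contracts.beta by (auto simp: psub_subst intro!: tranclp.r_into_trancl step.root)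
  next
    case (mu M N)
    then show ?thesis
      using root contracts.mu by (auto simp: psub_mu_rsubst intro!: tranclp.r_into_trancl step.root)
  next
    case (rho b M)
    obtain c where c: "\<nu> b = Some c"
      using root by blast
    let ?M = "rsubsts 0 (map lift_mu (\<pi> b)) (psub_mu \<sigma> \<nu> \<pi> M)"
    have "(step R)\<^sup>*\<^sup>* (Nam c (apps (Mu (psub_mu \<sigma> \<nu> \<pi> M)) (\<pi> b))) (Nam c (Mu ?M))"
      using mu_steps_apps[OF root(3)] by (rule rtranclp_map) (rule step.Nam)
    moreover have "step R (Nam c (Mu ?M)) (ren id (case_nat c id) ?M)"
      using root rho contracts.rho by (auto intro: step.root)
    ultimately show ?thesis
      using rho c by (simp add: psub_rho)
  next
    case (theta N)
    then have "M = Mu (Nam 0 (lift_mu M'))"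
      using lift_lower_mu by metis
    moreover have "step R (psub \<sigma> \<nu> \<pi> (Mu (Nam 0 (lift_mu M')))) (psub \<sigma> \<nu> \<pi> M')"
      using root(1) theta(1) by (simp add: psub_lift_mu step_Theta)
    ultimately show ?thesis by simp
  next
    case (eps M)
    have "step R (psub \<sigma> \<nu> \<pi> (Mu (Mu M))) (psub \<sigma> \<nu> \<pi> (Mu (lower_mu (erase 0 M))))"
      using root(1) eps(1) unfolding psub.simps psub_eps by (simp only: step_Eps)
    then show ?thesis
      unfolding eps by blast
  qed
next
  case (Lam M M')
  show ?case
    unfolding psub.simps by (rule tranclp_map[OF Lam.IH[OF Lam.prems]]) (rule step.Lam)
next
  case (AppL M M' N)
  show ?case
    unfolding psub.simps by (rule tranclp_map[OF AppL.IH[OF AppL.prems]]) (rule step.AppL)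
next
  case (AppR N N' M)
  show ?case
    unfolding psub.simps by (rule tranclp_map[OF AppR.IH[OF AppR.prems]]) (rule step.AppR)
next
  case (Nam M M' a)
  obtain c where "\<nu> a = Some c"
    using Nam by blast
  moreover have "(step R)\<^sup>+\<^sup>+ (psub \<sigma> \<nu> \<pi> M) (psub \<sigma> \<nu> \<pi> M')"
    by (rule Nam.IH) (use Nam.prems in auto)
  then have "(step R)\<^sup>+\<^sup>+ (Nam c (apps (psub \<sigma> \<nu> \<pi> M) (\<pi> a))) (Nam c (apps (psub \<sigma> \<nu> \<pi> M') (\<pi> a)))"
    by (rule tranclp_map) (intro step.Nam step_apps)
  ultimately show ?case by simp
next
  case (Mu M M')
  have "(step R)\<^sup>+\<^sup>+ (psub_mu \<sigma> \<nu> \<pi> M) (psub_mu \<sigma> \<nu> \<pi> M')"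
    by (rule Mu.IH) (use Mu.prems in \<open>auto split: nat.splits\<close>)
  then show ?case
    by (auto elim: tranclp_map intro: step.Mu)
qed

lemma step_ren: "step R M M' \<Longrightarrow> Mu_rule \<in> R \<Longrightarrow> (step R)\<^sup>+\<^sup>+ (ren f g M) (ren f g M')"
  unfolding ren_eq_psub by (rule step_psub) auto

lemma steps_ren:
  "(step R)\<^sup>*\<^sup>* M M' \<Longrightarrow> Mu_rule \<in> R \<Longrightarrow> (step R)\<^sup>*\<^sup>* (ren f g M) (ren f g M')"
  by (induction rule: rtranclp_induct)
    (auto dest: step_ren tranclp_into_rtranclp intro: rtranclp_trans)

text \<open>Substituted terms may be copied or dropped, so a single step in one of them becomes any
  number of steps, possibly none. Below binders they are lifted, and \<open>steps_ren\<close>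
  carries their reductions along.\<close>

lemma steps_psub_cong:
  "Mu_rule \<in> R \<Longrightarrow> (\<And>i. (step R)\<^sup>*\<^sup>* (\<sigma> i) (\<sigma>' i)) \<Longrightarrow>
    (\<And>a. list_all2 (step R)\<^sup>*\<^sup>* (\<pi> a) (\<pi>' a)) \<Longrightarrow>
    (step R)\<^sup>*\<^sup>* (psub \<sigma> \<nu> \<pi> M) (psub \<sigma>' \<nu> \<pi>' M)"
proof (induction M arbitrary: \<sigma> \<sigma>' \<nu> \<pi> \<pi>')
  case (Lam M)
  have "(step R)\<^sup>*\<^sup>* (psub_lam \<sigma> \<nu> \<pi> M) (psub_lam \<sigma>' \<nu> \<pi>' M)"
    by (rule Lam.IH)
      (use Lam.prems in \<open>auto split: nat.splits intro: steps_ren list_all2_map_mono\<close>)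
  then show ?case by (simp add: steps_Lam)
next
  case (Mu M)
  have "(step R)\<^sup>*\<^sup>* (psub_mu \<sigma> \<nu> \<pi> M) (psub_mu \<sigma>' \<nu> \<pi>' M)"
    by (rule Mu.IH)
      (use Mu.prems in \<open>auto split: nat.splits intro: steps_ren list_all2_map_mono\<close>)
  then show ?case by (simp add: steps_Mu)
qed (auto simp: steps_App intro!: steps_name steps_apps)

lemma step_subst: "step R M M' \<Longrightarrow> Mu_rule \<in> R \<Longrightarrow> (step R)\<^sup>+\<^sup>+ (subst 0 N M) (subst 0 N M')"
  unfolding subst_eq_psub by (rule step_psub) auto

lemma step_rsubst: "step R M M' \<Longrightarrow> Mu_rule \<in> R \<Longrightarrow> (step R)\<^sup>+\<^sup>+ (rsubst a N M) (rsubst a N M')"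
  unfolding rsubst_eq_psub by (rule step_psub) auto

lemma step_rsubsts:
  "step R M M' \<Longrightarrow> Mu_rule \<in> R \<Longrightarrow>
    (step R)\<^sup>+\<^sup>+ (rsubsts 0 (map lift_mu Ns) M) (rsubsts 0 (map lift_mu Ns) M')"
  unfolding rsubsts_eq_psub by (rule step_psub) auto

lemma steps_subst: "step R N N' \<Longrightarrow> Mu_rule \<in> R \<Longrightarrow> (step R)\<^sup>*\<^sup>* (subst 0 N M) (subst 0 N' M)"
  unfolding subst_eq_psub by (rule steps_psub_cong) auto

lemma steps_rsubst:
  "step R N N' \<Longrightarrow> Mu_rule \<in> R \<Longrightarrow>
    (step R)\<^sup>*\<^sup>* (rsubst 0 (lift_mu N) M) (rsubst 0 (lift_mu N') M)"
  unfolding rsubst_eq_psub by (rule steps_psub_cong) (auto intro: steps_ren)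

lemma steps_rsubsts:
  "list_all2 (step R)\<^sup>*\<^sup>* Ns Ns' \<Longrightarrow> Mu_rule \<in> R \<Longrightarrow>
    (step R)\<^sup>*\<^sup>* (rsubsts 0 (map lift_mu Ns) M) (rsubsts 0 (map lift_mu Ns') M)"
  unfolding rsubsts_eq_psub
  by (rule steps_psub_cong)
    (auto split: nat.splits intro: steps_ren list_all2_map_mono)


section \<open>Strong normalization\<close>

lemma termip_induct [consumes 1, case_names step]:
  assumes "termip r x" "\<And>x. termip r x \<Longrightarrow> (\<And>y. r x y \<Longrightarrow> P y) \<Longrightarrow> P x"
  shows "P x"
  by (rule accp_induct[OF assms(1)]) (simp add: assms(2))

text \<open>This gives access to induction along reductions. A term outside the accessible part has
  a successor outside it, so dependent choice yields an infinite reduction; conversely, the tail of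
  an infinite reduction starts at a successor.\<close>

lemma SN_iff: "M \<in> SN R \<longleftrightarrow> termip (step R) M"
proof
  assume "M \<in> SN R"
  show "termip (step R) M"
  proof (rule ccontr)
    assume "\<not> termip (step R) M"
    moreover have "\<exists>y. step R x y \<and> \<not> termip (step R) y" if "\<not> termip (step R) x" for x
      using that by (auto intro: accpI)
    ultimately obtain f where "f 0 = M" "\<And>n. \<not> termip (step R) (f n) \<and> step R (f n) (f (Suc n))"
      using dependent_nat_choice[of "\<lambda>n x. \<not> termip (step R) x \<and> (n = 0 \<longrightarrow> x = M)" "\<lambda>n. step R"]
      by (metis nat.distinct(1))
    with \<open>M \<in> SN R\<close> show False
      by (auto simp: SN_def)
  qed
next
  assume "termip (step R) M"
  then have "f 0 = M \<Longrightarrow> \<not> (\<forall>i. step R (f i) (f (Suc i)))" for f :: "nat \<Rightarrow> trm"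
  proof (induction arbitrary: f rule: termip_induct)
    case (step M)
    show ?case
    proof
      assume *: "\<forall>i. step R (f i) (f (Suc i))"
      then have "step R M (f 1)"
        using step.prems by (metis One_nat_def)
      from step.IH[OF this, of "\<lambda>i. f (Suc i)"] * show False
        by simp
    qed
  qed
  then show "M \<in> SN R"
    by (auto simp: SN_def)
qed

lemma termip_rtranclp: "r\<^sup>*\<^sup>* x y \<Longrightarrow> termip r x \<Longrightarrow> termip r y"
  by (induction rule: rtranclp_induct) (auto dest: accp_downward)

text \<open>Isolates a first step, so that an induction hypothesis about direct successors of
  \<open>x\<close> applies.\<close>

lemma rtranclp_tranclp_split: "r\<^sup>*\<^sup>* x y \<Longrightarrow> r\<^sup>+\<^sup>+ y z \<Longrightarrow> \<exists>w. r x w \<and> r\<^sup>*\<^sup>* w z"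
  by (meson rtranclp_tranclp_tranclp tranclpD)

text \<open>
  By \<open>quasi\<close>, the \<open>t\<close>-steps preserve the property that all \<open>s\<close>-successors are strongly normalizing
  for the union.
\<close>

lemma termip_quasi_commute:
  assumes quasi: "\<And>x y z. P x \<Longrightarrow> t x y \<Longrightarrow> s y z \<Longrightarrow> \<exists>w. s x w \<and> (\<lambda>x y. s x y \<or> t x y)\<^sup>*\<^sup>* w z"
    and pres: "\<And>x y. P x \<Longrightarrow> t x y \<Longrightarrow> P y" "\<And>x y. P x \<Longrightarrow> s x y \<Longrightarrow> P y"
    and decr: "\<And>x y. t x y \<Longrightarrow> m y < (m x :: nat)"
    and "termip s x" "P x"
  shows "termip (\<lambda>x y. s x y \<or> t x y) x"
  using \<open>termip s x\<close> \<open>P x\<close>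
proof (induction rule: termip_induct)
  case (step x)
  let ?r = "\<lambda>x y. s x y \<or> t x y"
  \<comment> \<open>Once all \<open>s\<close>-successors are known to terminate, only
    \<open>t\<close>-steps remain to be followed, and these decrease \<open>m\<close>. For
    \<open>x\<close> itself the assumption comes from the outer induction.\<close>
  have "\<forall>z. s y z \<longrightarrow> termip ?r z \<Longrightarrow> P y \<Longrightarrow> termip ?r y" for y
  proof (induction "m y" arbitrary: y rule: less_induct)
    case less
    have "termip ?r z" if "t y z" for z
    proof (rule less.hyps)
      show "m z < m y" "P z"
        using decr[OF that] pres(1)[OF _ that] less.prems by blast+
      show "\<forall>u. s z u \<longrightarrow> termip ?r u"
      proof (intro allI impI)
        fix u assume "s z u"
        \<comment> \<open>\<open>w\<close> is an \<open>s\<close>-successor of \<open>y\<close>, so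
          its termination is assumed; \<open>u\<close> inherits it as a reduct of
          \<open>w\<close>.\<close>
        with quasi that less.prems obtain w where "s y w" "?r\<^sup>*\<^sup>* w u"
          by meson
        with less.prems show "termip ?r u"
          by (blast intro: termip_rtranclp[of ?r])
      qed
    qed
    with less.prems show ?case
      by (auto intro: accpI)
  qed
  with step pres(2) show ?case by blast
qed

section \<open>Splitting the rules into \<beta>\<mu> and the size-decreasing ones\<close>

abbreviation betamu :: "trm \<Rightarrow> trm \<Rightarrow> bool" where
  "betamu \<equiv> step {Beta_rule, Mu_rule}"

abbreviation admin :: "trm \<Rightarrow> trm \<Rightarrow> bool" where
  "admin \<equiv> step {Rho_rule, Theta_rule, Eps_rule}"

abbreviation allr :: "trm \<Rightarrow> trm \<Rightarrow> bool" where
  "allr \<equiv> step {Beta_rule, Mu_rule, Rho_rule, Theta_rule, Eps_rule}"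

lemma allr_iff: "allr M N \<longleftrightarrow> betamu M N \<or> admin M N"
  using step_Un[of "{Beta_rule, Mu_rule}" "{Rho_rule, Theta_rule, Eps_rule}"] by (simp add: insert_commute)

lemma size_ren [simp]: "size (ren f g M) = size M"
  by (induction M arbitrary: f g) auto

lemma size_erase: "size (erase a M) \<le> size M"
  by (induction M arbitrary: a) (auto intro: le_SucI add_mono)

lemma size_admin: "admin M N \<Longrightarrow> size N < size M"
proof (induction rule: step.induct)
  case (root r M M')
  from root(2,1) show ?case
    by cases (auto simp: less_Suc_eq_le intro: le_SucI size_erase)
qed auto

section \<open>Inversion of steps, and reflection of \<beta>\<mu>-steps through renaming and
  erasure\<close>

inductive_cases step_VarE [elim!]: "step R (Var i) P"
inductive_cases step_LamE: "step R (Lam M) P"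
inductive_cases step_AppE: "step R (App M N) P"
inductive_cases step_NamE: "step R (Nam a M) P"
inductive_cases step_MuE: "step R (Mu M) P"
inductive_cases contracts_VarE [elim!]: "contracts r (Var i) P"
inductive_cases contracts_LamE [elim!]: "contracts r (Lam M) P"
inductive_cases contracts_AppE: "contracts r (App M N) P"
inductive_cases contracts_NamE: "contracts r (Nam a M) P"
inductive_cases contracts_MuE: "contracts r (Mu M) P"

lemma betamu_LamE:
  assumes "betamu (Lam M) P"
  obtains M' where "betamu M M'" "P = Lam M'"
  using assms by (auto elim: step_LamE)

lemma betamu_NamE:
  assumes "betamu (Nam a M) P"
  obtains M' where "betamu M M'" "P = Nam a M'"
  using assms by (auto elim!: step_NamE elim: contracts_NamE)

lemma betamu_MuE:
  assumes "betamu (Mu M) P"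
  obtains M' where "betamu M M'" "P = Mu M'"
  using assms by (auto elim!: step_MuE elim: contracts_MuE)

lemma betamu_AppE:
  assumes "betamu (App M N) P"
  obtains (Beta) M' where "M = Lam M'" "P = subst 0 N M'"
    | (Mu) M' where "M = Mu M'" "P = Mu (rsubst 0 (lift_mu N) M')"
    | (AppL) M' where "betamu M M'" "P = App M' N"
    | (AppR) N' where "betamu N N'" "P = App M N'"
  using assms by (auto elim!: step_AppE elim: contracts_AppE)

lemma betamu_Beta: "betamu (App (Lam M) N) (subst 0 N M)"
  and betamu_Mu: "betamu (App (Mu M) N) (Mu (rsubst 0 (lift_mu N) M))"
  by (auto intro: step.root contracts.intros)

text \<open>An abstraction could newly appear at the root only in place of a variable or by erasing
  a name. Variables are mapped to variables here, and a named term has type \<bottom>, not an arrow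
  type.\<close>

lemma psub_typing_Arrow_cases:
  assumes "typing \<Gamma> M (Arrow A B) \<Theta>" "\<And>i. \<exists>j. \<sigma> i = Var j"
  shows "psub \<sigma> \<nu> \<pi> M = Lam K \<Longrightarrow> \<exists>L. M = Lam L \<and> K = psub_lam \<sigma> \<nu> \<pi> L"
    and "psub \<sigma> \<nu> \<pi> M = Mu K \<Longrightarrow> \<exists>L. M = Mu L \<and> K = psub_mu \<sigma> \<nu> \<pi> L"
proof -
  have "\<sigma> i \<noteq> Lam K" "\<sigma> i \<noteq> Mu K" for i
    using assms(2)[of i] by auto
  then show "psub \<sigma> \<nu> \<pi> M = Lam K \<Longrightarrow> \<exists>L. M = Lam L \<and> K = psub_lam \<sigma> \<nu> \<pi> L"
    and "psub \<sigma> \<nu> \<pi> M = Mu K \<Longrightarrow> \<exists>L. M = Mu L \<and> K = psub_mu \<sigma> \<nu> \<pi> L"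
    using assms(1) by (cases M; auto elim: typing_NamE)+
qed

text \<open>A partial converse of \<open>step_psub\<close>, here with erasure allowed. Such a
  substitution could create a \<beta>\<mu>-redex only by changing the function part of an
  application into an abstraction, which \<open>psub_typing_Arrow_cases\<close> excludes.\<close>

lemma betamu_psub_reflect:
  "betamu (psub \<sigma> \<nu> \<pi> M) P \<Longrightarrow> typing \<Gamma> M A \<Theta> \<Longrightarrow> (\<And>i. \<exists>j. \<sigma> i = Var j) \<Longrightarrow>
    (\<And>a. \<pi> a = []) \<Longrightarrow> \<exists>M'. betamu M M' \<and> P = psub \<sigma> \<nu> \<pi> M'"
proof (induction M arbitrary: \<sigma> \<nu> \<pi> P \<Gamma> A \<Theta>)
  case (Var i)
  obtain j where "\<sigma> i = Var j"
    using Var by blast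
  with Var.prems(1) show ?case by auto
next
  case (Lam M)
  from Lam.prems(2) obtain C B where M: "typing (case_nat (Some C) \<Gamma>) M B \<Theta>"
    by (auto elim: typing_LamE)
  from Lam.prems(1) obtain P' where P: "betamu (psub_lam \<sigma> \<nu> \<pi> M) P'" "P = Lam P'"
    by (auto elim: betamu_LamE)
  have "\<exists>j. case_nat (Var 0) (\<lambda>i. lift_lam (\<sigma> i)) i = Var j" for i
    using Lam.prems(3) by (cases i) (auto, metis ren.simps(1))
  with Lam.IH[OF P(1) M] Lam.prems(4) obtain M' where "betamu M M'" "P' = psub_lam \<sigma> \<nu> \<pi> M'"
    by auto
  with P show ?case
    by (auto intro!: exI[of _ "Lam M'"] step.Lam)
next
  case (Mu M)
  from Mu.prems(2) obtain C B where M: "typing \<Gamma> M B (case_nat (Some C) \<Theta>)"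
    by (auto elim: typing_MuE)
  from Mu.prems(1) obtain P' where P: "betamu (psub_mu \<sigma> \<nu> \<pi> M) P'" "P = Mu P'"
    by (auto elim: betamu_MuE)
  have "\<exists>j. lift_mu (\<sigma> i) = Var j" for i
    using Mu.prems(3) by (metis ren.simps(1))
  moreover have "case_nat [] (\<lambda>a. map lift_mu (\<pi> a)) a = []" for a
    using Mu.prems(4) by (cases a) auto
  ultimately obtain M' where "betamu M M'" "P' = psub_mu \<sigma> \<nu> \<pi> M'"
    using Mu.IH[OF P(1) M] by blast
  with P show ?case
    by (auto intro!: exI[of _ "Mu M'"] step.Mu)
next
  case (Nam a M)
  from Nam.prems(2) obtain B where M: "typing \<Gamma> M B \<Theta>"
    by (auto elim: typing_NamE)
  have "betamu (name (\<nu> a) (psub \<sigma> \<nu> \<pi> M)) P"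
    using Nam.prems(1) Nam.prems(4)[of a] by (simp only: psub.simps apps_simps)
  then obtain P' where P: "betamu (psub \<sigma> \<nu> \<pi> M) P'" "P = name (\<nu> a) P'"
    by (cases "\<nu> a") (auto elim: betamu_NamE)
  obtain M' where "betamu M M'" "P' = psub \<sigma> \<nu> \<pi> M'"
    using Nam.IH[OF P(1) M Nam.prems(3,4)] by blast
  with P Nam.prems(4)[of a] show ?case
    by (auto intro!: exI[of _ "Nam a M'"] step.Nam)
next
  case (App M N)
  from App.prems(2) obtain B where M: "typing \<Gamma> M (Arrow B A) \<Theta>" and N: "typing \<Gamma> N B \<Theta>"
    by (auto elim: typing_AppE)
  note cases = psub_typing_Arrow_cases[where \<sigma> = \<sigma>, OF M App.prems(3)]
  from App.prems(1) have "betamu (App (psub \<sigma> \<nu> \<pi> M) (psub \<sigma> \<nu> \<pi> N)) P"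
    by simp
  then show ?case
  proof (cases rule: betamu_AppE)
    case (Beta K)
    with cases(1) obtain L where "M = Lam L" "K = psub_lam \<sigma> \<nu> \<pi> L"
      by blast
    with Beta show ?thesis
      by (auto intro!: exI[of _ "subst 0 N L"] betamu_Beta simp: psub_subst)
  next
    case (Mu K)
    with cases(2) obtain L where "M = Mu L" "K = psub_mu \<sigma> \<nu> \<pi> L"
      by blast
    with Mu show ?thesis
      by (auto intro!: exI[of _ "Mu (rsubst 0 (lift_mu N) L)"] betamu_Mu simp: psub_mu_rsubst)
  next
    case (AppL K)
    with App.IH(1)[where \<sigma> = \<sigma> and \<nu> = \<nu> and \<pi> = \<pi>, OF _ M App.prems(3,4)]
    obtain M' where "betamu M M'" "K = psub \<sigma> \<nu> \<pi> M'"
      by blast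
    with AppL show ?thesis
      by (auto intro!: exI[of _ "App M' N"] step.AppL)
  next
    case (AppR K)
    with App.IH(2)[where \<sigma> = \<sigma> and \<nu> = \<nu> and \<pi> = \<pi>, OF _ N App.prems(3,4)]
    obtain N' where "betamu N N'" "K = psub \<sigma> \<nu> \<pi> N'"
      by blast
    with AppR show ?thesis
      by (auto intro!: exI[of _ "App M N'"] step.AppR)
  qed
qed

lemma betamu_ren_reflect:
  "betamu (ren f g M) P \<Longrightarrow> typing \<Gamma> M A \<Theta> \<Longrightarrow> \<exists>M'. betamu M M' \<and> P = ren f g M'"
  unfolding ren_eq_psub by (erule betamu_psub_reflect) auto

lemma betamu_eps_reflect:
  "betamu (lower_mu (erase 0 M)) P \<Longrightarrow> typing \<Gamma> M A \<Theta> \<Longrightarrow>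
    \<exists>M'. betamu M M' \<and> P = lower_mu (erase 0 M')"
  unfolding eps_eq_psub by (erule betamu_psub_reflect) auto

section \<open>Postponement of \<rho>, \<theta> and \<epsilon>\<close>

lemma rsubst_eps:
  "rsubst 0 (lift_mu N) (lower_mu (erase 0 M)) =
    lower_mu (erase 0 (rsubst (Suc 0) (lift_mu (lift_mu N)) M))"
  unfolding eps_eq_psub rsubst_eq_psub psub_psub
  by (rule psub_cong)
    (auto simp: psub_ren simp flip: ren_eq_psub id_def split: nat.splits option.splits)

text \<open>Contracting a \<theta>-redex in function position can create a \<beta>- or \<mu>-redex.
  Instead, a \<mu>-step first moves \<open>K\<close> inside, next to \<open>N\<close>; the bound
  name is not free in \<open>N\<close>, so the result is again a \<theta>-redex, with contractum
  \<open>App N K\<close>.\<close>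

lemma theta_betamu_App:
  assumes "betamu (App N K) P"
  shows "\<exists>Q. betamu (App (Mu (Nam 0 (lift_mu N))) K) Q \<and> allr\<^sup>*\<^sup>* Q P"
proof -
  let ?Q = "Mu (Nam 0 (lift_mu (App N K)))"
  have 1: "betamu (App (Mu (Nam 0 (lift_mu N))) K) ?Q"
    using betamu_Mu[of "Nam 0 (lift_mu N)" K] by simp
  have "allr ?Q (App N K)"
    by (rule step_Theta) simp
  moreover have "allr (App N K) P"
    using assms by (simp add: allr_iff)
  ultimately have "allr\<^sup>*\<^sup>* ?Q P"
    by (meson converse_rtranclp_into_rtranclp rtranclp.rtrancl_refl)
  with 1 show ?thesis by blast
qed

text \<open>Applied to the function part of an application, this lists the ways in which an
  abstraction can arise there. A named term, and hence a \<rho>-redex at the root, is excluded by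
  its type \<bottom>.\<close>

lemma admin_Arrow_cases:
  assumes "admin M N" "typing \<Gamma> M (Arrow A B) \<Theta>"
  obtains (Theta) "M = Mu (Nam 0 (lift_mu N))"
    | (Eps) K where "M = Mu (Mu K)" "N = Mu (lower_mu (erase 0 K))"
    | (Lam) K K' where "M = Lam K" "N = Lam K'" "admin K K'"
    | (Mu) K K' where "M = Mu K" "N = Mu K'" "admin K K'"
    | (App) K L where "N = App K L"
  using assms(1)
proof cases
  case (root r)
  from root(2,1) show ?thesis
  proof cases
    case (rho b K)
    with assms(2) show ?thesis by (auto elim: typing_NamE)
  next
    case (theta K)
    then show ?thesis
      using that(1) lift_lower_mu by metis
  next
    case (eps K)
    then show ?thesis using that(2) by blast
  qed auto
qed (use assms that in \<open>auto elim: typing_NamE\<close>)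

text \<open>The induction is on the position of the first step. At the root, \<rho> and \<epsilon>
  use reflection of the \<beta>\<mu>-step, and \<theta> uses lifting. In an application, the
  delicate case is a \<beta>\<mu>-redex at its root: the redex is already present before the first
  step, unless \<theta> in function position created it.\<close>

lemma admin_quasi_commute:
  "admin M N \<Longrightarrow> typing \<Gamma> M A \<Theta> \<Longrightarrow> betamu N P \<Longrightarrow> \<exists>Q. betamu M Q \<and> allr\<^sup>*\<^sup>* Q P"
proof (induction arbitrary: \<Gamma> A \<Theta> P rule: step.induct)
  case (root r M N)
  from root(2,1) show ?case
  proof cases
    case (rho b K)
    from root.prems(1) rho obtain B \<Theta>' where "typing \<Gamma> K B \<Theta>'"
      by (auto elim!: typing_NamE typing_MuE)
    with root.prems(2) rho obtain K' where "betamu K K'" "P = ren id (case_nat b id) K'"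
      using betamu_ren_reflect by metis
    then have "betamu M (Nam b (Mu K'))" "allr (Nam b (Mu K')) P"
      unfolding rho by (auto intro: step.Mu step.Nam step_Rho)
    then show ?thesis by blast
  next
    case (theta K)
    then have M: "M = Mu (Nam 0 (lift_mu N))"
      using lift_lower_mu by metis
    \<comment> \<open>The \<beta>\<mu>-step is replayed inside the \<theta>-redex. Lifting is only
      known to give a nonempty sequence; its first step provides \<open>Q\<close>.\<close>
    have "betamu\<^sup>+\<^sup>+ (lift_mu N) (lift_mu P)"
      using root.prems(2) by (rule step_ren) simp
    then have "betamu\<^sup>+\<^sup>+ (Mu (Nam 0 (lift_mu N))) (Mu (Nam 0 (lift_mu P)))"
      by (rule tranclp_map) (auto intro: step.intros)
    then obtain Q where Q: "betamu M Q" "betamu\<^sup>*\<^sup>* Q (Mu (Nam 0 (lift_mu P)))"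
      using M tranclpD by metis
    from Q(2) have "allr\<^sup>*\<^sup>* Q (Mu (Nam 0 (lift_mu P)))"
      by (rule rtranclp_map[where f = "\<lambda>x. x"]) (simp add: allr_iff)
    moreover have "allr (Mu (Nam 0 (lift_mu P))) P"
      by (rule step_Theta) simp
    ultimately show ?thesis using Q(1)
      by (meson rtranclp.rtrancl_into_rtrancl)
  next
    case (eps K)
    from root.prems(1) eps obtain B \<Theta>' where K: "typing \<Gamma> K B \<Theta>'"
      by (auto elim!: typing_MuE)
    from root.prems(2) eps obtain P' where P': "betamu (lower_mu (erase 0 K)) P'" "P = Mu P'"
      using betamu_MuE by metis
    obtain K' where "betamu K K'" "P' = lower_mu (erase 0 K')"
      using betamu_eps_reflect[OF P'(1) K] by metis
    then have "betamu M (Mu (Mu K'))" "allr (Mu (Mu K')) P"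
      unfolding eps P'(2) by (auto intro: step.Mu step_Eps simp del: One_nat_def)
    then show ?thesis by blast
  qed auto
next
  case (Lam M N)
  from Lam.prems obtain P' where "betamu N P'" "P = Lam P'"
    by (auto elim: betamu_LamE)
  moreover obtain \<Gamma>' B where "typing \<Gamma>' M B \<Theta>"
    using Lam.prems(1) by (auto elim: typing_LamE)
  ultimately show ?case
    using Lam.IH by (metis steps_Lam step.Lam)
next
  case (Mu M N)
  from Mu.prems obtain P' where "betamu N P'" "P = Mu P'"
    by (auto elim: betamu_MuE)
  moreover obtain \<Theta>' B where "typing \<Gamma> M B \<Theta>'"
    using Mu.prems(1) by (auto elim: typing_MuE)
  ultimately show ?case
    using Mu.IH by (metis steps_Mu step.Mu)
next
  case (Nam M N a)
  from Nam.prems obtain P' where "betamu N P'" "P = Nam a P'"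
    by (auto elim: betamu_NamE)
  moreover obtain B where "typing \<Gamma> M B \<Theta>"
    using Nam.prems(1) by (auto elim: typing_NamE)
  ultimately show ?case
    using Nam.IH steps_name[where n = "Some a"] by (metis name.simps(2) step.Nam)
next
  case (AppR K K' M)
  obtain B where M: "typing \<Gamma> M (Arrow B A) \<Theta>" and K: "typing \<Gamma> K B \<Theta>"
    using AppR.prems(1) by (auto elim: typing_AppE)
  have KK': "allr K K'"
    using AppR.hyps by (simp add: allr_iff)
  from AppR.prems(2) show ?case
  proof (cases rule: betamu_AppE)
    case (Beta L)
    \<comment> \<open>The argument is substituted unreduced, and its copies are reduced
      afterwards.\<close>
    then show ?thesis
      using steps_subst[OF KK'] betamu_Beta by blast
  next
    case (Mu L)
    then show ?thesis
      using steps_rsubst[OF KK'] steps_Mu betamu_Mu by blast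
  next
    case (AppL M')
    have "allr (App M' K) (App M' K')"
      using KK' by (rule step.AppR)
    with AppL show ?thesis
      using step.AppL by blast
  next
    case (AppR P')
    then show ?thesis
      using AppR.IH[OF K] steps_App[of _ M M] step.AppR by blast
  qed
next
  case (AppL M N K)
  obtain B where M: "typing \<Gamma> M (Arrow B A) \<Theta>" and K: "typing \<Gamma> K B \<Theta>"
    using AppL.prems(1) by (auto elim: typing_AppE)
  have MN: "allr M N"
    using AppL.hyps by (simp add: allr_iff)
  show ?case
  \<comment> \<open>A \<theta>-redex in function position is answered by the same \<mu>-step
    whatever the \<beta>\<mu>-step is, so it is split off first.\<close>
  proof (cases "M = Mu (Nam 0 (lift_mu N))")
    case True
    with AppL.prems(2) show ?thesis
      using theta_betamu_App by blast
  next
    case no_theta: False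
    from AppL.prems(2) show ?thesis
    proof (cases rule: betamu_AppE)
      case (Beta L)
      have "\<exists>L'. M = Lam L' \<and> admin L' L"
        using AppL.hyps M by (cases rule: admin_Arrow_cases) (use no_theta Beta in auto)
      then obtain L' where L': "M = Lam L'" "allr L' L"
        by (auto simp: allr_iff)
      then have "betamu (App M K) (subst 0 K L')"
        by (simp add: betamu_Beta)
      moreover have "allr\<^sup>*\<^sup>* (subst 0 K L') P"
        using step_subst[OF L'(2)] Beta by (simp add: tranclp_into_rtranclp)
      ultimately show ?thesis by blast
    next
      case (Mu L)
      have "(\<exists>L'. M = Mu L' \<and> admin L' L) \<or> (\<exists>L'. M = Mu (Mu L') \<and> L = lower_mu (erase 0 L'))"
        using AppL.hyps M by (cases rule: admin_Arrow_cases) (use no_theta Mu in auto)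
      then show ?thesis
      proof (elim disjE exE conjE)
        fix L' assume L': "M = Mu L'" "admin L' L"
        then have "allr L' L"
          by (simp add: allr_iff)
        then have "allr\<^sup>*\<^sup>* (Mu (rsubst 0 (lift_mu K) L')) P"
          using step_rsubst Mu by (metis insertI1 insert_commute steps_Mu tranclp_into_rtranclp)
        with L' show ?thesis
          using betamu_Mu by blast
      next
        fix L' assume L': "M = Mu (Mu L')" "L = lower_mu (erase 0 L')"
        \<comment> \<open>The outer \<mu> takes the argument before \<epsilon> merges the two
          binders; \<open>rsubst_eps\<close> says that the results agree.\<close>
        have "allr (Mu (rsubst 0 (lift_mu K) (Mu L'))) P"
          unfolding Mu L' rsubst_eps rsubst.simps by (rule step_Eps) simp
        with L' show ?thesis
          using betamu_Mu by blast
      qed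
    next
      case (AppL M')
      then show ?thesis
        using AppL.IH[OF M] steps_App[of _ _ _ K K] step.AppL by blast
    next
      case (AppR K')
      have "allr (App M K') (App N K')"
        using MN by (rule step.AppL)
      with AppR show ?thesis
        using step.AppR by blast
    qed
  qed
qed

text \<open>The step from \<beta>\<mu> to all rules is \<open>termip_quasi_commute\<close> with
  typability as the invariant, preserved by subject reduction, and the size as the measure.\<close>

lemma termip_allr_iff:
  assumes "typing \<Gamma> M A \<Theta>"
  shows "termip allr M \<longleftrightarrow> termip betamu M"
proof
  assume "termip allr M"
  then show "termip betamu M"
    by (induction rule: termip_induct) (auto intro: accpI simp: allr_iff)
next
  have eq: "allr = (\<lambda>M N. betamu M N \<or> admin M N)"
    by (simp add: fun_eq_iff allr_iff)
  assume "termip betamu M"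
  then show "termip allr M"
    unfolding eq
  proof (rule termip_quasi_commute[where P = "\<lambda>M. \<exists>\<Gamma> A \<Theta>. typing \<Gamma> M A \<Theta>" and m = size, rotated -2])
    show "\<exists>w. betamu x w \<and> (\<lambda>M N. betamu M N \<or> admin M N)\<^sup>*\<^sup>* w z"
      if "\<exists>\<Gamma> A \<Theta>. typing \<Gamma> x A \<Theta>" "admin x y" "betamu y z" for x y z
      using that admin_quasi_commute unfolding eq by blast
  qed (use assms typing_step size_admin in blast)+
qed


section \<open>Closure properties of strong normalization for \<beta>\<mu>\<close>

lemma termip_congs:
  shows termip_Lam: "termip betamu M \<Longrightarrow> termip betamu (Lam M)"
    and termip_Mu: "termip betamu M \<Longrightarrow> termip betamu (Mu M)"
    and termip_Nam: "termip betamu M \<Longrightarrow> termip betamu (Nam a M)"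
  by (induction rule: termip_induct; blast intro: accpI elim: betamu_LamE betamu_MuE betamu_NamE)+

lemma termip_MuD:
  assumes "termip betamu (Mu M)"
  shows "termip betamu M"
proof -
  have "termip betamu K \<Longrightarrow> K = Mu M \<Longrightarrow> termip betamu M" for K M
    by (induction arbitrary: M rule: termip_induct) (blast intro: accpI step.Mu)
  with assms show ?thesis by blast
qed

text \<open>Every step of the renamed term is reflected to \<open>M\<close>. This is needed since
  \<open>lam\<close> and \<open>mu\<close> bind a variable by means of a renaming.\<close>

lemma termip_ren:
  "termip betamu M \<Longrightarrow> typing \<Gamma> M A \<Theta> \<Longrightarrow> termip betamu (ren f g M)"
proof (induction rule: termip_induct)
  case (step M)
  show ?case
  proof (rule accpI)
    fix P assume "betamu\<inverse>\<inverse> P (ren f g M)"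
    then obtain M' where "betamu M M'" "P = ren f g M'"
      using betamu_ren_reflect step.prems by blast
    with step typing_step show "termip betamu P" by metis
  qed
qed

lemma listrel1p_iff:
  "listrel1p r xs ys \<longleftrightarrow> (\<exists>us x y vs. r x y \<and> xs = us @ x # vs \<and> ys = us @ y # vs)"
  by (auto simp: listrel1p_def listrel1_def)

text \<open>Allows a single induction over all arguments of an application, each step reducing one
  of them.\<close>

lemma termip_listrel1p:
  assumes "\<forall>x\<in>set xs. termip r x"
  shows "termip (listrel1p r) xs"
proof -
  let ?R = "{(x, y). r x y}"
  have "xs \<in> lists (Wellfounded.acc (?R\<inverse>))"
    using assms by (auto simp: accp_acc_eq[symmetric] Wellfounded.acc_def conversep.simps
        conversep_iff[abs_def])
  then have "xs \<in> Wellfounded.acc ((listrel1 ?R)\<inverse>)"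
    using lists_accD by (fastforce simp: listrel1_converse)
  then show ?thesis
    by (simp add: Wellfounded.acc_def listrel1p_def[abs_def] conversep_iff[abs_def])
qed

lemma betamu_apps_right: "listrel1p betamu Ns Ns' \<Longrightarrow> betamu (apps M Ns) (apps M Ns')"
  by (auto simp: listrel1p_iff intro!: step_apps step.AppR)

text \<open>Application nests to the left, so the induction removes the last argument. A redex at
  the outermost application forces the remaining list to be empty, since a nonempty one would make
  the function part an application.\<close>

lemma betamu_appsE:
  assumes "betamu (apps H Ns) P"
  obtains (Head) H' where "betamu H H'" "P = apps H' Ns"
    | (Args) Ns' where "listrel1p betamu Ns Ns'" "P = apps H Ns'"
    | (Beta) M N Ns' where "H = Lam M" "Ns = N # Ns'" "P = apps (subst 0 N M) Ns'"
    | (Mu) M N Ns' where "H = Mu M" "Ns = N # Ns'" "P = apps (Mu (rsubst 0 (lift_mu N) M)) Ns'"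
  using assms
proof (induction Ns arbitrary: P thesis rule: rev_induct)
  case Nil
  then show ?case by simp
next
  case (snoc N Ns)
  have app: "apps H Ns = K \<Longrightarrow> Ns = [] \<and> H = K \<or> (\<exists>L L'. K = App L L')" for K
    by (cases Ns rule: rev_cases) auto
  from snoc.prems(5) have "betamu (App (apps H Ns) N) P" by simp
  then show ?case
  proof (cases rule: betamu_AppE)
    case (Beta M)
    moreover from this app[of "Lam M"] have "Ns = []" "H = Lam M" by auto
    ultimately show ?thesis
      using snoc.prems(3)[of M N "[]"] by (simp only: append_Nil apps_simps simp_thms)
  next
    case (Mu M)
    moreover from this app[of "Mu M"] have "Ns = []" "H = Mu M" by auto
    ultimately show ?thesis
      using snoc.prems(4)[of M N "[]"] by (simp only: append_Nil apps_simps simp_thms)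
  next
    case (AppR N')
    then have "listrel1p betamu (Ns @ [N]) (Ns @ [N'])"
      by (auto simp: listrel1p_iff)
    with AppR snoc.prems(2) show ?thesis by simp
  next
    case (AppL K)
    note P = \<open>P = App K N\<close>
    show ?thesis
    proof (rule snoc.IH[OF _ _ _ _ AppL(1)], goal_cases)
      case (1 H')
      with P snoc.prems(1) show ?case by simp
    next
      case (2 Ns')
      then have "listrel1p betamu (Ns @ [N]) (Ns' @ [N])"
        by (fastforce simp: listrel1p_iff)
      with 2 P snoc.prems(2) show ?case by simp
    next
      case (3 M N' Ns')
      with P snoc.prems(3)[of M N' "Ns' @ [N]"] show ?case by simp
    next
      case (4 M N' Ns')
      with P snoc.prems(4)[of M N' "Ns' @ [N]"] show ?case by simp
    qed
  qed
qed

text \<open>A variable in head position never forms a redex, so every step reduces one of the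
  arguments.\<close>

lemma termip_apps_Var:
  assumes "\<forall>N\<in>set Ns. termip betamu N"
  shows "termip betamu (apps (Var x) Ns)"
proof -
  from assms have "termip (listrel1p betamu) Ns"
    by (rule termip_listrel1p)
  then show ?thesis
  proof (induction rule: termip_induct)
    case (step Ns)
    show ?case
    proof (rule accpI)
      fix P assume "betamu\<inverse>\<inverse> P (apps (Var x) Ns)"
      then have "betamu (apps (Var x) Ns) P" by simp
      then show "termip betamu P"
        by (cases rule: betamu_appsE) (use step.IH in \<open>blast, blast, simp_all\<close>)
    qed
  qed
qed

text \<open>
  The induction is over all \<open>B\<close> that reduce to \<open>(M[x := N])Ps\<close>, because a step in \<open>N\<close> may leave
  this term unchanged.
\<close>

lemma termip_beta_expansion:
  assumes "termip betamu (apps (subst 0 N M) Ps)" "termip betamu N"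
  shows "termip betamu (apps (App (Lam M) N) Ps)"
proof -
  have "termip betamu (apps (App (Lam M) N) Ps)"
    if "termip betamu B" "termip betamu N" "betamu\<^sup>*\<^sup>* B (apps (subst 0 N M) Ps)" for B
    using that
  proof (induction B arbitrary: M N Ps rule: termip_induct)
    case outer: (step B)
    \<comment> \<open>Steps in \<open>M\<close> and \<open>Ps\<close> are matched by at least one
      step of the contractum, so the outer induction applies at a successor of
      \<open>B\<close>.\<close>
    have red: "termip betamu (apps (App (Lam M') N') Ps')"
      if "betamu\<^sup>*\<^sup>* B (apps (subst 0 N M) Ps)" "termip betamu N'"
        "betamu\<^sup>+\<^sup>+ (apps (subst 0 N M) Ps) (apps (subst 0 N' M') Ps')" for M N Ps M' N' Ps'
      using outer.IH that(2) rtranclp_tranclp_split[OF that(1,3)] by metis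
    from outer.prems show ?case
    proof (induction N rule: termip_induct)
      case inner: (step N)
      show ?case
      proof (rule accpI)
        fix P assume "betamu\<inverse>\<inverse> P (apps (App (Lam M) N) Ps)"
        then have "betamu (apps (App (Lam M) N) Ps) P" by simp
        then show "termip betamu P"
        proof (cases rule: betamu_appsE)
          case (Head H')
          from Head(1) show ?thesis
          proof (cases rule: betamu_AppE)
            case (Beta M')
            with Head have "P = apps (subst 0 N M) Ps" by simp
            with outer.hyps inner.prems show ?thesis
              by (blast intro: termip_rtranclp)
          next
            case (AppL K)
            then obtain M' where M': "betamu M M'" "K = Lam M'"
              by (auto elim: betamu_LamE)
            then have "betamu\<^sup>+\<^sup>+ (apps (subst 0 N M) Ps) (apps (subst 0 N M') Ps)"
              by (intro tranclp_map[OF step_subst]) (auto intro: step_apps)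
            with red inner M' Head AppL show ?thesis by metis
          next
            case (AppR N')
            \<comment> \<open>The contractum may stay the same, so \<open>B\<close> is kept and the
              inner induction on \<open>N\<close> is used.\<close>
            have "betamu\<^sup>*\<^sup>* (apps (subst 0 N M) Ps) (apps (subst 0 N' M) Ps)"
              using AppR(1) by (intro rtranclp_map[OF steps_subst]) (auto intro: step_apps)
            with inner.prems have "betamu\<^sup>*\<^sup>* B (apps (subst 0 N' M) Ps)"
              by (rule rtranclp_trans)
            then have "termip betamu (apps (App (Lam M) N') Ps)"
              using inner.IH AppR(1) by blast
            with Head AppR show ?thesis by blast
          qed auto
        next
          case (Args Ps')
          then have "betamu\<^sup>+\<^sup>+ (apps (subst 0 N M) Ps) (apps (subst 0 N M) Ps')"
            by (blast intro: betamu_apps_right)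
          with red inner Args show ?thesis by metis
        qed auto
      qed
    qed
  qed
  with assms show ?thesis by blast
qed

text \<open>Three nested inductions match the three kinds of steps. A \<mu>-step at the head uses up
  an argument and decreases \<open>n\<close>; a step in \<open>M\<close> is matched by a step from
  \<open>B\<close>; a step in an argument may leave no trace in the replacement, so the list
  \<open>Ns\<close> itself decreases.\<close>

lemma termip_mu_expansion:
  assumes "\<forall>N\<in>set Ns. termip betamu N" "termip betamu (rsubsts 0 (map lift_mu Ns) M)"
  shows "termip betamu (apps (Mu M) Ns)"
proof -
  have "termip betamu (apps (Mu M) Ns)"
    if "length Ns = n" "\<forall>N\<in>set Ns. termip betamu N" "termip betamu B"
      "betamu\<^sup>*\<^sup>* B (rsubsts 0 (map lift_mu Ns) M)" for n B
    using that
  proof (induction n arbitrary: Ns M B rule: less_induct)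
    case (less n)
    from less.prems(3,1,2,4) show ?case
    proof (induction B arbitrary: Ns M rule: termip_induct)
      case outer: (step B)
      from outer.prems(2) have "termip (listrel1p betamu) Ns"
        by (rule termip_listrel1p)
      then show ?case
        using outer.prems
      proof (induction Ns rule: termip_induct)
        case inner: (step Ns)
        show ?case
        proof (rule accpI)
          fix P assume "betamu\<inverse>\<inverse> P (apps (Mu M) Ns)"
          then have "betamu (apps (Mu M) Ns) P" by simp
          then show "termip betamu P"
          proof (cases rule: betamu_appsE)
            case (Head H')
            then obtain M' where M': "betamu M M'" "H' = Mu M'"
              by (auto elim: betamu_MuE)
            then have "betamu\<^sup>+\<^sup>+ (rsubsts 0 (map lift_mu Ns) M) (rsubsts 0 (map lift_mu Ns) M')"
              by (intro step_rsubsts) auto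
            with inner.prems(3) obtain B' where
              "betamu B B'" "betamu\<^sup>*\<^sup>* B' (rsubsts 0 (map lift_mu Ns) M')"
              using rtranclp_tranclp_split by metis
            with outer.IH[of B' Ns M'] inner.prems(1,2) M' Head show ?thesis by blast
          next
            case (Args Ns')
            then have "list_all2 betamu\<^sup>*\<^sup>* Ns Ns'"
              by (auto simp: listrel1p_iff intro!: list_all2_appendI list.rel_refl)
            then have "betamu\<^sup>*\<^sup>* (rsubsts 0 (map lift_mu Ns) M) (rsubsts 0 (map lift_mu Ns') M)"
              by (rule steps_rsubsts) simp
            with inner.prems(3) have red: "betamu\<^sup>*\<^sup>* B (rsubsts 0 (map lift_mu Ns') M)"
              by (rule rtranclp_trans)
            have len: "length Ns' = n"
              using Args(1) inner.prems(1) by (auto simp: listrel1p_iff)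
            obtain us N N' vs where N: "betamu N N'" "Ns = us @ N # vs" "Ns' = us @ N' # vs"
              using Args(1) by (auto simp: listrel1p_iff)
            have "termip betamu N'"
              using N inner.prems(2) by (metis termip_rtranclp r_into_rtranclp in_set_conv_decomp)
            moreover have "set Ns' \<subseteq> insert N' (set Ns)"
              using N by auto
            ultimately have "\<forall>N\<in>set Ns'. termip betamu N"
              using inner.prems(2) by blast
            then have "termip betamu (apps (Mu M) Ns')"
              using inner.IH Args(1) red len by blast
            with Args show ?thesis by blast
          next
            case (Mu M' N Ns')
            \<comment> \<open>\<open>rsubsts\<close> processes its first argument first, so the head
              step leaves the replaced term unchanged; \<open>B\<close> is kept while the number of
              arguments drops.\<close>
            show ?thesis
              unfolding Mu(3)
            proof (rule less.IH[of "length Ns'"])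
              show "length Ns' < n"
                using Mu(2) inner.prems(1) by simp
              show "\<forall>N\<in>set Ns'. termip betamu N"
                using Mu(2) inner.prems(2) by (metis list.set_intros(2))
              show "termip betamu B"
                by (fact outer.hyps)
              show "betamu\<^sup>*\<^sup>* B (rsubsts 0 (map lift_mu Ns') (rsubst 0 (lift_mu N) M'))"
                using Mu(1,2) inner.prems(3) by (simp only: list.map rsubsts_simps trm.inject)
            qed simp
          qed auto
        qed
      qed
    qed
  qed
  with assms show ?thesis by blast
qed

section \<open>Saturation\<close>

lemma termip_SN_typable:
  "M \<in> typable \<Longrightarrow>
    M \<in> SN {Beta_rule, Mu_rule, Rho_rule, Theta_rule, Eps_rule} \<longleftrightarrow> termip betamu M"
  by (auto simp: typable_def SN_iff termip_allr_iff)

lemma lam_typable: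
  assumes "M \<in> typable"
  shows "lam x M \<in> typable"
proof -
  from assms obtain \<Gamma> A \<Theta> where fin: "finite (dom \<Gamma>)" "finite (dom \<Theta>)" and M: "typing \<Gamma> M A \<Theta>"
    by (auto simp: typable_def)
  \<comment> \<open>If \<open>\<Gamma>\<close> assigns no type to \<open>x\<close>, then
    \<open>x\<close> is not free in \<open>M\<close>, and \<bottom> serves as an arbitrary type for
    the bound variable.\<close>
  define B where "B = (case \<Gamma> x of None \<Rightarrow> Bot | Some B \<Rightarrow> B)"
  have "typing (case_nat (Some B) \<Gamma>) (ren (\<lambda>y. if y = x then 0 else Suc y) id M) A \<Theta>"
    using M by (rule typing_ren) (auto simp: B_def)
  then have "typing \<Gamma> (lam x M) (Arrow B A) \<Theta>"
    unfolding lam_def by (rule ArrowI)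
  with fin show ?thesis
    by (auto simp: typable_def)
qed

theorem theorem4p15:
  "saturated (SN {Beta_rule, Mu_rule, Rho_rule, Theta_rule, Eps_rule} \<inter> typable)"
proof -
  let ?B = "SN {Beta_rule, Mu_rule, Rho_rule, Theta_rule, Eps_rule} \<inter> typable"
  \<comment> \<open>On typable terms the five rules can be exchanged for \<beta>\<mu>, so all
    conditions are checked for \<beta>\<mu> alone.\<close>
  have B: "?B = {M \<in> typable. termip betamu M}"
    using termip_SN_typable by blast
  have ren: "termip betamu (ren f g M)" if "M \<in> typable" "termip betamu M" for f g M
    using that termip_ren by (auto simp: typable_def)
  show ?thesis
    unfolding saturated_def B
  proof (intro conjI allI impI; (elim CollectE conjE)?)
    fix x M assume "M \<in> typable" "termip betamu M"
    then show "lam x M \<in> {M \<in> typable. termip betamu M}"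
      using lam_typable ren termip_Lam by (auto simp: lam_def)
  next
    fix a M assume "M \<in> typable" "termip betamu M" "mu a M \<in> typable"
    then show "mu a M \<in> {M \<in> typable. termip betamu M}"
      using ren termip_Mu by (auto simp: mu_def)
  next
    fix M Ns assume *: "set Ns \<subseteq> {M \<in> typable. termip betamu M}" "apps (Mu M) Ns \<in> typable"
      "termip betamu (Mu (rsubsts 0 (map lift_mu Ns) M))"
    \<comment> \<open>C6 speaks of the abstraction, while \<open>termip_mu_expansion\<close> works
      with its body.\<close>
    have "termip betamu (rsubsts 0 (map lift_mu Ns) M)"
      using *(3) by (rule termip_MuD)
    with * show "apps (Mu M) Ns \<in> {M \<in> typable. termip betamu M}"
      using termip_mu_expansion by auto
  \<comment> \<open>What remains is the inclusion in the typable terms and C3, C4 and C5.\<close>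
  qed (auto intro: termip_Nam termip_apps_Var termip_beta_expansion)
qed

end
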